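(* Let $2\le p<\infty$, let $\Omega\subset\mathbb{H}$ be a bounded domain, and let $\Omega'\subset\mathbb{H}$ be an open set containing $\overline\Omega$. Let $U$ be a smooth function in $\Omega'$ such that $\Delta^N_{\mathbb{H},p}U=0$ and $\nabla_{\mathbb{H}}U\ne0$ in $\Omega'$. For $\varepsilon\in(0,1)$ sufficiently small (so that $\Omega_\varepsilon\subset\Omega'$) let $u_\varepsilon\in\mathcal{B}(\Omega_\varepsilon)$ be the solution of $$u_\varepsilon(x)=\mu^{\mathbb{H}}_p(u_\varepsilon,\varepsilon)(x)\ \text{ for } x\in\Omega,\qquad u_\varepsilon(x)=U(x)\ \text{ for } x\in\Gamma^{\mathbb{H}}_\varepsilon .$$ Then $u_\varepsilon\to U$ uniformly in $\overline\Omega$ as $\varepsilon\to0$.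
   Context: Heisenberg group: $\mathbb{H}=(\mathbb{R}^3,* )$ with $(x_1,x_2,x_3)*(y_1,y_2,y_3)=(x_1+y_1,\,x_2+y_2,\,x_3+y_3+\tfrac12(x_1y_2-x_2y_1))$. The Korányi gauge is $|x|_{\mathbb{H}}=((x_1^2+x_2^2)^2+16x_3^2)^{1/4}$, the metric is $d_{\mathbb{H}}(x,y)=|x^{-1}*y|_{\mathbb{H}}$, and $B^{\mathbb{H}}_r(x_0)=\{x\in\mathbb{H}: d_{\mathbb{H}}(x_0,x)<r\}$. Horizontal operators: $X_1=\partial_{x_1}-\tfrac{x_2}{2}\partial_{x_3}$, $X_2=\partial_{x_2}+\tfrac{x_1}{2}\partial_{x_3}$; $\nabla_{\mathbb{H}}u=(X_1u,X_2u)$; $\Delta_{\mathbb{H}}u=X_1^2u+X_2^2u$; $D^{2,*}_{\mathbb{H}}u$ is the $2\times2$ matrix with entries $\tfrac12(X_iX_ju+X_jX_iu)$. Where $\nabla_{\mathbb{H}}u\ne0$, the normalized $p$-Laplacian is $$\Delta^N_{\mathbb{H},p}u=(p-2)\Big\langle D^{2,*}_{\mathbb{H}}u\,\tfrac{\nabla_{\mathbb{H}}u}{|\nabla_{\mathbb{H}}u|},\tfrac{\nabla_{\mathbb{H}}u}{|\nabla_{\mathbb{H}}u|}\Big\rangle+\Delta_{\mathbb{H}}u .$$ Boundary strips: for $0<\varepsilon\le1$, $\Gamma^{\mathbb{H}}_\varepsilon=\{x\in\mathbb{H}\setminus\Omega:\operatorname{dist}_{\mathbb{H}}(x,\Omega)\le\varepsilon\}$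 and $\Omega_\varepsilon=\Omega\cup\Gamma^{\mathbb{H}}_\varepsilon$. $\mathcal{B}(\Omega_\varepsilon)$ is the set of bounded Lebesgue measurable real functions on $\Omega_\varepsilon$. Natural $p$-mean: for $1<p<\infty$, $\phi\in\mathcal{B}(\Omega_\varepsilon)$ and $x\in\overline\Omega$, $\mu^{\mathbb{H}}_p(\phi,\varepsilon)(x)$ is the unique real number $\lambda$ minimizing $\|\phi-\lambda\|_{L^p(\overline{B^{\mathbb{H}}_\varepsilon(x)})}$ (with respect to Lebesgue measure on $\mathbb{R}^3$). It is known that the boundary value problem in the claim has a unique solution $u_\varepsilon\in\mathcal{B}(\Omega_\varepsilon)$. *)

theory Defs
  imports "HOL-Analysis.Analysis"
begin

text \<open>
  The Heisenberg group has underlying set \<open>real^3\<close>. Its topology, its bounded sets and its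
  Lebesgue measurable sets are those of Euclidean space.
\<close>

definition heis_mult :: "real^3 \<Rightarrow> real^3 \<Rightarrow> real^3" where
  "heis_mult x y =
     vector [x$1 + y$1, x$2 + y$2, x$3 + y$3 + (x$1 * y$2 - x$2 * y$1) / 2]"

definition koranyi_gauge :: "real^3 \<Rightarrow> real" where
  "koranyi_gauge x = (((x$1)\<^sup>2 + (x$2)\<^sup>2)\<^sup>2 + 16 * (x$3)\<^sup>2) powr (1/4)"

text \<open>The group inverse of \<open>x\<close> is \<open>-x\<close>.\<close>

lemma heis_mult_uminus: "heis_mult (- x) x = 0" "heis_mult x (- x) = 0"
  by (simp_all add: heis_mult_def vec_eq_iff forall_3)

definition heis_dist :: "real^3 \<Rightarrow> real^3 \<Rightarrow> real" where
  "heis_dist x y = koranyi_gauge (heis_mult (- x) y)"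

definition heis_ball :: "real^3 \<Rightarrow> real \<Rightarrow> (real^3) set" where
  "heis_ball x r = {y. heis_dist x y < r}"

definition heis_infdist :: "real^3 \<Rightarrow> (real^3) set \<Rightarrow> real" where
  "heis_infdist x A = (INF y\<in>A. heis_dist x y)"

definition boundary_strip :: "(real^3) set \<Rightarrow> real \<Rightarrow> (real^3) set" where
  "boundary_strip \<Omega> \<epsilon> = {x. x \<notin> \<Omega> \<and> heis_infdist x \<Omega> \<le> \<epsilon>}"

definition extended_domain :: "(real^3) set \<Rightarrow> real \<Rightarrow> (real^3) set" where
  "extended_domain \<Omega> \<epsilon> = \<Omega> \<union> boundary_strip \<Omega> \<epsilon>"

definition partial :: "3 \<Rightarrow> (real^3 \<Rightarrow> real) \<Rightarrow> real^3 \<Rightarrow> real" where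
  "partial i u x = deriv (\<lambda>t. u (x + t *\<^sub>R axis i 1)) 0"

text \<open>\<open>C\<^sup>k\<close> regularity; meaningful for open \<open>S\<close>.\<close>

primrec Ck_on :: "nat \<Rightarrow> (real^3 \<Rightarrow> real) \<Rightarrow> (real^3) set \<Rightarrow> bool" where
  "Ck_on 0 u S \<longleftrightarrow> continuous_on S u"
| "Ck_on (Suc k) u S \<longleftrightarrow> u differentiable_on S \<and> (\<forall>i. Ck_on k (partial i u) S)"

definition smooth_on :: "(real^3 \<Rightarrow> real) \<Rightarrow> (real^3) set \<Rightarrow> bool" where
  "smooth_on u S \<longleftrightarrow> (\<forall>k. Ck_on k u S)"

definition horiz :: "2 \<Rightarrow> (real^3 \<Rightarrow> real) \<Rightarrow> real^3 \<Rightarrow> real" where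
  "horiz i u x =
     (if i = 1 then partial 1 u x - x$2 / 2 * partial 3 u x
      else partial 2 u x + x$1 / 2 * partial 3 u x)"

definition horiz_grad :: "(real^3 \<Rightarrow> real) \<Rightarrow> real^3 \<Rightarrow> real^2" where
  "horiz_grad u x = (\<chi> i. horiz i u x)"

definition horiz_laplacian :: "(real^3 \<Rightarrow> real) \<Rightarrow> real^3 \<Rightarrow> real" where
  "horiz_laplacian u x = horiz 1 (horiz 1 u) x + horiz 2 (horiz 2 u) x"

definition sym_horiz_hessian :: "(real^3 \<Rightarrow> real) \<Rightarrow> real^3 \<Rightarrow> real^2^2" where
  "sym_horiz_hessian u x =
     (\<chi> i j. (horiz i (horiz j u) x + horiz j (horiz i u) x) / 2)"

text \<open>Used only where the horizontal gradient does not vanish.\<close>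

definition normalized_p_laplacian :: "real \<Rightarrow> (real^3 \<Rightarrow> real) \<Rightarrow> real^3 \<Rightarrow> real" where
  "normalized_p_laplacian p u x =
     (let n = horiz_grad u x /\<^sub>R norm (horiz_grad u x)
      in (p - 2) * ((sym_horiz_hessian u x *v n) \<bullet> n) + horiz_laplacian u x)"

text \<open>
  Functions on a subset of the group are total functions whose values outside that subset
  are ignored.
\<close>

definition bounded_measurable_on :: "(real^3) set \<Rightarrow> (real^3 \<Rightarrow> real) set" where
  "bounded_measurable_on S = {\<phi>. bounded (\<phi> ` S) \<and> \<phi> \<in> borel_measurable (lebesgue_on S)}"

definition Lp_norm_on :: "real \<Rightarrow> (real^3) set \<Rightarrow> (real^3 \<Rightarrow> real) \<Rightarrow> real" where
  "Lp_norm_on p A f = (LINT y:A|lebesgue. \<bar>f y\<bar> powr p) powr (1/p)"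

definition natural_p_mean :: "real \<Rightarrow> (real^3 \<Rightarrow> real) \<Rightarrow> real \<Rightarrow> real^3 \<Rightarrow> real" where
  "natural_p_mean p \<phi> \<epsilon> x =
     (THE l. is_arg_min (\<lambda>m. Lp_norm_on p (closure (heis_ball x \<epsilon>)) (\<lambda>y. \<phi> y - m))
               (\<lambda>_. True) l)"

definition p_mean_solution ::
  "real \<Rightarrow> (real^3) set \<Rightarrow> (real^3 \<Rightarrow> real) \<Rightarrow> real \<Rightarrow> (real^3 \<Rightarrow> real) \<Rightarrow> bool" where
  "p_mean_solution p \<Omega> U \<epsilon> u \<longleftrightarrow>
     u \<in> bounded_measurable_on (extended_domain \<Omega> \<epsilon>) \<and>
     (\<forall>x\<in>\<Omega>. u x = natural_p_mean p u \<epsilon> x) \<and>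
     (\<forall>x\<in>boundary_strip \<Omega> \<epsilon>. u x = U x)"

end

theory Submission
  imports Defs
begin

text \<open>
  The \<open>p\<close>-mean of \<open>\<phi>\<close> over a ball is the unique root \<open>\<lambda>\<close> of \<open>\<integral> \<psi>(\<phi> - \<lambda>) = 0\<close>, where
  \<open>\<psi>(s) = sgn s * \<bar>s\<bar> powr (p - 1)\<close>, which makes it monotone in \<open>\<phi>\<close>. Instead of the asymptotic
  expansion of the mean of \<open>U\<close> one perturbs \<open>U\<close>: for \<open>\<sigma> = 1\<close> or \<open>\<sigma> = -1\<close> and small \<open>\<delta> > 0\<close> the function
  \<open>V = \<sigma> U + \<delta> U\<^sup>2\<close> satisfies \<open>\<integral> \<psi>(V - V(x) - \<epsilon>\<^sup>3) > 0\<close> on the \<open>\<epsilon>\<close>-ball around every \<open>x\<close>, for all small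
  \<open>\<epsilon>\<close>. Indeed, after rescaling to the unit ball and dividing by \<open>\<epsilon>\<close>, dominated convergence
  gives a limit in which the second-order terms of \<open>U\<close> enter only through its normalized
  \<open>p\<close>-Laplacian and hence cancel, while \<open>\<delta> \<bar>\<nabla>U\<bar>\<^sup>2\<close> contributes a positive term. At a point where \<open>V - \<sigma> u\<^sub>\<epsilon>\<close>
  nearly attains its supremum, monotonicity of the mean then forces that point into the boundary
  strip, where the difference is \<open>\<delta> U\<^sup>2\<close>. Hence \<open>\<bar>U - u\<^sub>\<epsilon>\<bar> \<le> \<delta> sup U\<^sup>2\<close>.
\<close>

section \<open>Signed powers\<close>

text \<open>\<open>p * spow p\<close> is the derivative of the p-th power of the absolute value, so
  \<open>spow p\<close> yields the stationarity condition of the p-mean.\<close>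

definition spow :: "real \<Rightarrow> real \<Rightarrow> real" where
  "spow p s = sgn s * \<bar>s\<bar> powr (p - 1)"

text \<open>The derivative of \<^term>\<open>spow p\<close>. The case \<open>p = 2\<close> is separate because \<open>0 powr 0 = 0\<close>.\<close>

definition dspow :: "real \<Rightarrow> real \<Rightarrow> real" where
  "dspow p s = (if p = 2 then 1 else (p - 1) * \<bar>s\<bar> powr (p - 2))"

lemma spow_minus [simp]: "spow p (- s) = - spow p s"
  by (simp add: spow_def)

lemma spow_mult: "spow p (c * s) = spow p c * spow p s"
  by (simp add: spow_def sgn_mult abs_mult powr_mult)

lemma spow_mult_pos: "c > 0 \<Longrightarrow> spow p (c * s) = c powr (p - 1) * spow p s"
  by (simp add: spow_def sgn_mult abs_mult powr_mult)

lemma spow_0 [simp]: "spow p 0 = 0"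
  by (simp add: spow_def)

lemma spow_pos: "s > 0 \<Longrightarrow> spow p s > 0"
  by (simp add: spow_def)

lemma dspow_minus [simp]: "dspow p (- s) = dspow p s"
  by (simp add: dspow_def)

lemma dspow_mult: "c \<noteq> 0 \<Longrightarrow> dspow p (c * s) = \<bar>c\<bar> powr (p - 2) * dspow p s"
  by (simp add: dspow_def abs_mult powr_mult)

text \<open>Euler's relation for the (p - 1)-homogeneous function \<open>spow p\<close>, multiplied
  once more by \<open>s\<close>.\<close>

lemma dspow_times_square: "p \<ge> 2 \<Longrightarrow> dspow p s * s\<^sup>2 = (p - 1) * (spow p s * s)"
proof (cases "s = 0")
  case False
  assume "p \<ge> 2"
  have "\<bar>s\<bar> powr (p - 2) * s\<^sup>2 = \<bar>s\<bar> powr (p - 2) * \<bar>s\<bar> powr 2"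
    using False by (simp add: powr_numeral)
  also have "\<dots> = \<bar>s\<bar> powr (p - 1) * \<bar>s\<bar> powr 1"
    unfolding powr_add[symmetric] by simp
  also have "\<dots> = spow p s * s"
    using False by (simp add: spow_def sgn_if)
  finally show ?thesis
    using False by (auto simp: dspow_def spow_def sgn_if power2_eq_square)
qed simp

section \<open>Differentiability, continuity and monotonicity of signed powers\<close>

text \<open>Both difference quotients at 0 have absolute value at most
  \<open>\<bar>h\<bar> powr (r - 1)\<close>, which tends to 0 since \<open>r > 1\<close>.\<close>

lemma abs_powr_has_derivative_0:
  assumes "r > 1"
  shows "((\<lambda>s::real. \<bar>s\<bar> powr r) has_real_derivative 0) (at 0)"
    and "((\<lambda>s::real. sgn s * \<bar>s\<bar> powr r) has_real_derivative 0) (at 0)"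
proof -
  have lim: "((\<lambda>h::real. \<bar>h\<bar> powr (r - 1)) \<longlongrightarrow> 0) (at 0)"
    using assms by (intro tendsto_zero_powrI[where b = "r - 1"]) (auto intro!: tendsto_eq_intros)
  have eq: "\<bar>h\<bar> powr (r - 1) = \<bar>h\<bar> powr r / \<bar>h\<bar>" for h :: real
    by (cases "h = 0") (auto simp: powr_diff)
  show "((\<lambda>s::real. \<bar>s\<bar> powr r) has_real_derivative 0) (at 0)"
    unfolding has_field_derivative_iff
    by (rule Lim_null_comparison[OF _ lim]) (auto simp: eq)
  show "((\<lambda>s::real. sgn s * \<bar>s\<bar> powr r) has_real_derivative 0) (at 0)"
    unfolding has_field_derivative_iff
    by (rule Lim_null_comparison[OF _ lim]) (auto simp: eq abs_mult abs_sgn_eq)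
qed

lemma abs_powr_has_derivative:
  assumes "r > 1"
  shows "((\<lambda>s::real. \<bar>s\<bar> powr r) has_real_derivative r * (sgn s * \<bar>s\<bar> powr (r - 1))) (at s)"
    and "((\<lambda>s::real. sgn s * \<bar>s\<bar> powr r) has_real_derivative r * \<bar>s\<bar> powr (r - 1)) (at s)"
proof -
  consider "s = 0" | "s > 0" | "s < 0" by linarith
  then have "((\<lambda>s::real. \<bar>s\<bar> powr r) has_real_derivative r * (sgn s * \<bar>s\<bar> powr (r - 1))) (at s)
    \<and> ((\<lambda>s::real. sgn s * \<bar>s\<bar> powr r) has_real_derivative r * \<bar>s\<bar> powr (r - 1)) (at s)"
  proof cases
    case 1 then show ?thesis using abs_powr_has_derivative_0[OF assms] assms by simp
  next
    case 2
    have e: "\<forall>\<^sub>F x in nhds s. 0 < x" using eventually_nhds_in_open[of "{0<..}" s] 2 by simp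
    have d: "((\<lambda>s. s powr r) has_real_derivative r * s powr (r - 1)) (at s)"
      using 2 by (auto intro!: derivative_eq_intros)
    have "((\<lambda>s. \<bar>s\<bar> powr r) has_real_derivative r * s powr (r - 1)) (at s)"
      by (rule DERIV_cong_ev[THEN iffD1, OF refl _ refl d], rule eventually_mono[OF e]) auto
    moreover have "((\<lambda>s. sgn s * \<bar>s\<bar> powr r) has_real_derivative r * s powr (r - 1)) (at s)"
      by (rule DERIV_cong_ev[THEN iffD1, OF refl _ refl d], rule eventually_mono[OF e]) auto
    ultimately show ?thesis using 2 by simp
  next
    case 3
    have e: "\<forall>\<^sub>F x in nhds s. x < 0" using eventually_nhds_in_open[of "{..<0}" s] 3 by simp
    have d: "((\<lambda>s. (- s) powr r) has_real_derivative - (r * (- s) powr (r - 1))) (at s)"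
      using 3 by (auto intro!: derivative_eq_intros)
    have d2: "((\<lambda>s. - ((- s) powr r)) has_real_derivative r * (- s) powr (r - 1)) (at s)"
      using DERIV_minus[OF d] by simp
    have "((\<lambda>s. \<bar>s\<bar> powr r) has_real_derivative - (r * (- s) powr (r - 1))) (at s)"
      by (rule DERIV_cong_ev[THEN iffD1, OF refl _ refl d], rule eventually_mono[OF e]) auto
    moreover have "((\<lambda>s. sgn s * \<bar>s\<bar> powr r) has_real_derivative r * (- s) powr (r - 1)) (at s)"
      by (rule DERIV_cong_ev[THEN iffD1, OF refl _ refl d2], rule eventually_mono[OF e]) auto
    ultimately show ?thesis using 3 by simp
  qed
  then show "((\<lambda>s::real. \<bar>s\<bar> powr r) has_real_derivative r * (sgn s * \<bar>s\<bar> powr (r - 1))) (at s)"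
    "((\<lambda>s::real. sgn s * \<bar>s\<bar> powr r) has_real_derivative r * \<bar>s\<bar> powr (r - 1)) (at s)"
    by auto
qed

lemma spow_two: "spow 2 s = s"
  by (cases "s = 0") (auto simp: spow_def sgn_if)

lemma abs_powr_DERIV_spow:
  "p \<ge> 2 \<Longrightarrow> ((\<lambda>s. \<bar>s\<bar> powr p) has_real_derivative p * spow p s) (at s)"
  using abs_powr_has_derivative(1)[of p s] by (simp add: spow_def)

text \<open>The general formula requires the exponent \<open>p - 1\<close> to exceed 1, so
  \<open>p = 2\<close>, where \<open>spow\<close> is the identity, is treated apart.\<close>

lemma spow_DERIV: "p \<ge> 2 \<Longrightarrow> (spow p has_real_derivative dspow p s) (at s)"
proof (cases "p = 2")
  case True
  have "spow 2 = (\<lambda>s. s)" by (simp add: fun_eq_iff spow_two)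
  then show ?thesis using True by (simp add: dspow_def)
next
  case False
  assume "p \<ge> 2"
  then show ?thesis using abs_powr_has_derivative(2)[of "p - 1" s] False
    by (simp add: spow_def [abs_def] dspow_def)
qed

lemma spow_continuous: "p \<ge> 2 \<Longrightarrow> continuous_on A (spow p)"
  by (meson DERIV_isCont continuous_at_imp_continuous_on spow_DERIV)

lemma dspow_continuous: "p \<ge> 2 \<Longrightarrow> continuous_on A (dspow p)"
proof (cases "p = 2")
  case False
  assume "p \<ge> 2"
  with False show ?thesis
    unfolding dspow_def [abs_def]
    by (auto intro!: continuous_intros continuous_on_powr')
qed (simp add: dspow_def [abs_def])

lemma continuous_on_spow [continuous_intros]:
  "p \<ge> 2 \<Longrightarrow> continuous_on A f \<Longrightarrow> continuous_on A (\<lambda>x. spow p (f x))"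
  by (rule continuous_on_compose2[OF spow_continuous]) auto

lemma continuous_on_dspow [continuous_intros]:
  "p \<ge> 2 \<Longrightarrow> continuous_on A f \<Longrightarrow> continuous_on A (\<lambda>x. dspow p (f x))"
  by (rule continuous_on_compose2[OF dspow_continuous]) auto

lemma spow_strict_mono: "p \<ge> 2 \<Longrightarrow> s < t \<Longrightarrow> spow p s < spow p t"
proof -
  assume p: "p \<ge> 2" and st: "s < t"
  have pos: "spow p a < spow p b" if "0 \<le> a" "a < b" for a b
    using that p by (auto simp: spow_def sgn_if intro: powr_less_mono2)
  consider "0 \<le> s" | "t \<le> 0" | "s < 0" "0 < t" by linarith
  then show ?thesis
  proof cases
    case 1 then show ?thesis using pos st by blast
  next
    case 2 then show ?thesis using pos[of "- t" "- s"] st by simp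
  next
    case 3 then show ?thesis using spow_pos[of t p] spow_pos[of "- s" p] by simp
  qed
qed

lemma spow_mono: "p \<ge> 2 \<Longrightarrow> s \<le> t \<Longrightarrow> spow p s \<le> spow p t"
  using spow_strict_mono[of p s t] by (cases "s = t") auto

lemma abs_spow_le: "p \<ge> 2 \<Longrightarrow> \<bar>s\<bar> \<le> t \<Longrightarrow> \<bar>spow p s\<bar> \<le> spow p t"
  using spow_mono[of p s t] spow_mono[of p "- s" t] by (simp add: abs_le_iff)

lemma abs_dspow_le: "p \<ge> 2 \<Longrightarrow> \<bar>s\<bar> \<le> t \<Longrightarrow> \<bar>dspow p s\<bar> \<le> dspow p t"
  by (auto simp: dspow_def abs_mult intro!: mult_left_mono powr_mono2)

lemma borel_measurable_spow: "p \<ge> 2 \<Longrightarrow> spow p \<in> borel_measurable borel"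
  using spow_continuous by (rule borel_measurable_continuous_onI)

lemma (in finite_measure) integrable_spow:
  fixes f :: "'a \<Rightarrow> real"
  assumes p: "2 \<le> p" and f[measurable]: "f \<in> borel_measurable M"
    and B: "\<And>x. x \<in> space M \<Longrightarrow> \<bar>f x\<bar> \<le> B"
  shows "integrable M (\<lambda>x. spow p (f x))"
proof (rule integrable_const_bound[where B = "spow p B"])
  show "AE x in M. norm (spow p (f x)) \<le> spow p B"
    using abs_spow_le[OF p B] by (auto intro!: AE_I2)
qed (use borel_measurable_spow[OF p] in measurable)

text \<open>Strict convexity: the mean value theorem gives a slope strictly between the slopes at
  the end points, because \<open>spow p\<close> is strictly increasing.\<close>

lemma abs_powr_tangent:
  assumes "p \<ge> 2" "a \<noteq> b"
  shows "\<bar>b\<bar> powr p > \<bar>a\<bar> powr p + p * spow p a * (b - a)"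
proof -
  have "\<bar>d\<bar> powr p - \<bar>c\<bar> powr p > p * spow p c * (d - c) \<and>
        \<bar>c\<bar> powr p - \<bar>d\<bar> powr p > p * spow p d * (c - d)" if cd: "c < d" for c d
  proof -
    obtain z where z: "c < z" "z < d" "\<bar>d\<bar> powr p - \<bar>c\<bar> powr p = (d - c) * (p * spow p z)"
      using MVT2[OF cd, of "\<lambda>s. \<bar>s\<bar> powr p" "\<lambda>s. p * spow p s"] abs_powr_DERIV_spow[OF assms(1)]
      by blast
    have "(d - c) * (p * spow p c) < (d - c) * (p * spow p z)"
      "(d - c) * (p * spow p z) < (d - c) * (p * spow p d)"
      using cd z assms by (auto intro!: mult_strict_left_mono spow_strict_mono)
    then show ?thesis using z by (auto simp: algebra_simps)
  qed
  then show ?thesis using assms(2) by (cases a b rule: linorder_cases) (force simp: algebra_simps)+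
qed

section \<open>The natural mean as a root\<close>

text \<open>At \<open>l = - B\<close> the integrand is nonnegative and at \<open>l = B\<close>
  nonpositive, so the intermediate value theorem applies; continuity in \<open>l\<close> follows by
  dominated convergence.\<close>

lemma (in finite_measure) integral_spow_has_root:
  fixes f :: "'a \<Rightarrow> real"
  assumes p: "2 \<le> p" and f[measurable]: "f \<in> borel_measurable M"
    and B: "\<And>x. x \<in> space M \<Longrightarrow> \<bar>f x\<bar> \<le> B" and B0: "B \<ge> 0"
  shows "\<exists>l. (\<integral>x. spow p (f x - l) \<partial>M) = 0"
proof -
  have [measurable]: "spow p \<in> borel_measurable borel"
    by (rule borel_measurable_spow[OF p])
  let ?H = "\<lambda>l. \<integral>x. spow p (f x - l) \<partial>M"
  have cont: "continuous_on {-B..B} ?H"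
    unfolding continuous_on_sequentially
  proof (intro allI ballI impI, unfold o_def)
    fix X l assume l: "l \<in> {-B..B}" and "(\<forall>n. X n \<in> {-B..B}) \<and> X \<longlonglongrightarrow> l"
    then have X: "\<And>n. \<bar>X n\<bar> \<le> B" "X \<longlonglongrightarrow> l" by (auto simp: abs_le_iff minus_le_iff)
    show "(\<lambda>n. ?H (X n)) \<longlonglongrightarrow> ?H l"
    proof (rule integral_dominated_convergence[where w = "\<lambda>_. spow p (2 * B)"])
      show "AE x in M. (\<lambda>n. spow p (f x - X n)) \<longlonglongrightarrow> spow p (f x - l)"
        by (intro AE_I2 isCont_tendsto_compose[OF DERIV_isCont[OF spow_DERIV[OF p]]] tendsto_intros X)
      fix n
      have "\<bar>spow p (f x - X n)\<bar> \<le> spow p (2 * B)" if "x \<in> space M" for x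
        using B[OF that] X(1)[of n] by (intro abs_spow_le[OF p]) linarith
      then show "AE x in M. norm (spow p (f x - X n)) \<le> spow p (2 * B)"
        by (auto intro!: AE_I2)
    qed (auto simp: p)
  qed
  have "0 \<le> (\<integral>x. spow p (- (f x - B)) \<partial>M)"
    using B spow_mono[OF p, of 0] by (intro integral_nonneg_AE AE_I2) (force simp: abs_le_iff)
  then have "?H B \<le> 0" by (simp only: spow_minus integral_minus neg_0_le_iff_le)
  moreover have "0 \<le> ?H (- B)"
    using B spow_mono[OF p, of 0] by (intro integral_nonneg_AE AE_I2) (force simp: abs_le_iff)
  ultimately show ?thesis
    using IVT2'[of ?H B 0 "- B"] cont B0 by auto
qed

text \<open>Any root \<open>l\<close> of the stationarity equation is the strict minimizer:
  integrating the tangent inequality at \<open>f y - l\<close> kills the linear term. Hence the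
  definite description denotes that root.\<close>

lemma natural_p_mean_root:
  assumes p: "2 \<le> p" and A: "closure (heis_ball x \<epsilon>) \<in> lmeasurable" 
    and pos: "measure lebesgue (closure (heis_ball x \<epsilon>)) > 0"
    and f: "f \<in> borel_measurable (lebesgue_on (closure (heis_ball x \<epsilon>)))"
    and bd: "bounded (f ` closure (heis_ball x \<epsilon>))"
  shows "(LINT y|lebesgue_on (closure (heis_ball x \<epsilon>)). spow p (f y - natural_p_mean p f \<epsilon> x)) = 0"
proof -
  define A where "A = closure (heis_ball x \<epsilon>)"
  define M where "M = lebesgue_on A"
  have A: "A \<in> lmeasurable" "measure lebesgue A > 0" using assms by (auto simp: A_def)
  then have As: "A \<in> sets lebesgue" by blast
  have spM: "space M = A" by (simp add: M_def)
  interpret finite_measure M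
    unfolding M_def using A(1) by (rule finite_measure_lebesgue_on)
  have f [measurable]: "f \<in> borel_measurable M" using f by (simp add: M_def A_def)
  obtain B where "B > 0" "\<forall>y\<in>A. \<bar>f y\<bar> \<le> B"
    using bd unfolding bounded_pos A_def by auto
  then have B: "\<And>y. y \<in> A \<Longrightarrow> \<bar>f y\<bar> \<le> B" and B0: "B \<ge> 0" by auto
  obtain l where l: "(\<integral>y. spow p (f y - l) \<partial>M) = 0"
    using integral_spow_has_root[OF p f, of B] B B0 spM by auto
  have [measurable]: "spow p \<in> borel_measurable borel" 
    by (rule borel_measurable_spow[OF p])
  have int1: "integrable M (\<lambda>y. spow p (f y - m))" for m
    by (rule integrable_spow[OF p, where B = "B + \<bar>m\<bar>"])
      (auto simp: spM intro!: order_trans[OF abs_triangle_ineq4] B)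
  have int2: "integrable M (\<lambda>y. \<bar>f y - m\<bar> powr p)" for m
  proof (rule integrable_const_bound[where B = "(B + \<bar>m\<bar>) powr p"])
    have "\<bar>f x - m\<bar> powr p \<le> (B + \<bar>m\<bar>) powr p" if "x \<in> A" for x
      using B[OF that] p by (intro powr_mono2) linarith+
    then show "AE x in M. norm (\<bar>f x - m\<bar> powr p) \<le> (B + \<bar>m\<bar>) powr p"
      by (auto intro!: AE_I2 simp: spM)
  qed measurable
  have L: "Lp_norm_on p A (\<lambda>y. f y - m) = (\<integral>y. \<bar>f y - m\<bar> powr p \<partial>M) powr (1 / p)" for m
    unfolding Lp_norm_on_def M_def set_lebesgue_integral_def
    by (simp add: integral_restrict_space As)
  have less: "(\<integral>y. \<bar>f y - l\<bar> powr p \<partial>M) < (\<integral>y. \<bar>f y - m\<bar> powr p \<partial>M)" if "m \<noteq> l" for m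
  proof -
    \<comment> \<open>The linear term stays under the integral so that the pointwise strict tangent
      inequality can be integrated; positive measure keeps it strict.\<close>
    have "(\<integral>y. \<bar>f y - l\<bar> powr p + p * (l - m) * spow p (f y - l) \<partial>M) < (\<integral>y. \<bar>f y - m\<bar> powr p \<partial>M)"
    proof (rule integral_less_AE_space)
      show "AE y in M. \<bar>f y - l\<bar> powr p + p * (l - m) * spow p (f y - l) < \<bar>f y - m\<bar> powr p"
      proof (rule AE_I2)
        fix y
        show "\<bar>f y - l\<bar> powr p + p * (l - m) * spow p (f y - l) < \<bar>f y - m\<bar> powr p"
          using abs_powr_tangent[OF p, of "f y - l" "f y - m"] that by (simp add: algebra_simps)
      qed
      show "emeasure M (space M) \<noteq> 0"
        using A As by (simp add: M_def emeasure_restrict_space measure_def zero_less_iff_neq_zero)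
          (metis enn2real_0 less_irrefl)
    qed (auto intro!: integrable_add int1 int2 integrable_mult_right)
    then show ?thesis using l int1 int2 by simp
  qed
  have less': "Lp_norm_on p A (\<lambda>y. f y - l) < Lp_norm_on p A (\<lambda>y. f y - m)" if "m \<noteq> l" for m
    unfolding L using less[OF that] p by (intro powr_less_mono2) auto
  have "natural_p_mean p f \<epsilon> x = l"
    unfolding natural_p_mean_def A_def[symmetric]
  proof (rule the_equality)
    show "is_arg_min (\<lambda>m. Lp_norm_on p A (\<lambda>y. f y - m)) (\<lambda>_. True) l"
      using less' unfolding is_arg_min_def by (metis less_asym less_irrefl)
    show "m = l" if "is_arg_min (\<lambda>m. Lp_norm_on p A (\<lambda>y. f y - m)) (\<lambda>_. True) m" for m
      using that less' unfolding is_arg_min_def by metis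
  qed
  then show ?thesis using l by (simp add: M_def A_def)
qed

section \<open>Balls and change of variables\<close>

lemma integrable_lebesgue_on_compact:
  fixes f :: "'a::euclidean_space \<Rightarrow> 'b::euclidean_space"
  assumes "compact S" "continuous_on S f"
  shows "integrable (lebesgue_on S) f"
proof -
  have S: "S \<in> lmeasurable" using assms(1) by (rule lmeasurable_compact)
  then interpret finite_measure "lebesgue_on S" by (rule finite_measure_lebesgue_on)
  obtain B where "\<forall>x\<in>S. norm (f x) \<le> B"
    using compact_imp_bounded[OF compact_continuous_image[OF assms(2,1)]] by (auto simp: bounded_iff)
  then show ?thesis
    using continuous_imp_measurable_on_sets_lebesgue[OF assms(2)] S
    by (intro integrable_const_bound[where B = B] AE_I2) auto
qed

lemma integral_affine_image_compact:
  fixes f :: "real^'n::{finite,wellorder} \<Rightarrow> real" and g :: "real^'n::_ \<Rightarrow> real^'n::_"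
  assumes g: "linear g" "det (matrix g) \<noteq> 0" and S: "compact S"
    and f: "continuous_on ((\<lambda>z. x + g z) ` S) f"
  shows "integrable (lebesgue_on S) (\<lambda>z. f (x + g z))"
    and "(LINT y|lebesgue_on ((\<lambda>z. x + g z) ` S). f y)
      = \<bar>det (matrix g)\<bar> * (LINT z|lebesgue_on S. f (x + g z))"
proof -
  let ?T = "\<lambda>z. x + g z"
  have contT: "continuous_on S ?T"
    using g(1) by (intro continuous_intros linear_continuous_on linear_conv_bounded_linear[THEN iffD1])
  have cT: "compact (?T ` S)" using contT S by (rule compact_continuous_image)
  have cfT: "continuous_on S (\<lambda>z. f (?T z))"
    using continuous_on_compose2[OF f contT] by auto
  show int: "integrable (lebesgue_on S) (\<lambda>z. f (x + g z))"
    by (rule integrable_lebesgue_on_compact[OF S cfT])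
  have intf: "integrable (lebesgue_on (?T ` S)) f"
    by (rule integrable_lebesgue_on_compact[OF cT f])
  have S': "S \<in> sets lebesgue" "?T ` S \<in> sets lebesgue" 
    using S cT by (auto intro: lmeasurable_compact[THEN fmeasurableD])
  have abs: "f absolutely_integrable_on ?T ` S"
    using intf S' by (simp add: integrable_restrict_space set_integrable_def)
  have inj: "inj_on ?T S"
    using g det_nz_iff_inj[OF g(1)] by (auto simp: inj_on_def)
  have der: "(?T has_derivative g) (at z within S)" for z
    using g(1) by (auto intro!: derivative_eq_intros linear_imp_has_derivative)
  \<comment> \<open>The change-of-variables theorem is stated for vector-valued integrands, so
    \<open>f\<close> is passed through \<open>real^1\<close>.\<close>
  have "(\<lambda>z. \<bar>det (matrix g)\<bar> *\<^sub>R (vec (f (?T z)) :: real^1)) absolutely_integrable_on S \<and>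
        integral S (\<lambda>z. \<bar>det (matrix g)\<bar> *\<^sub>R (vec (f (?T z)) :: real^1)) = vec (integral (?T ` S) f)"
    using has_absolute_integral_change_of_variables[OF S'(1) der inj, of "\<lambda>y. vec (f y) :: real^1"]
      abs by (simp add: absolutely_integrable_on_1_iff integral_on_1_eq)
  then have "integral S (\<lambda>z. \<bar>det (matrix g)\<bar> * f (?T z)) = integral (?T ` S) f"
    by (simp add: integral_on_1_eq vec_eq_iff)
  then show "(LINT y|lebesgue_on (?T ` S). f y) = \<bar>det (matrix g)\<bar> * (LINT z|lebesgue_on S. f (x + g z))"
    using lebesgue_integral_eq_integral[OF intf S'(2)] lebesgue_integral_eq_integral[OF int S'(1)]
    by simp
qed

section \<open>The closed unit ball, rotated frames and the shape of metric balls\<close>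

text \<open>The closed unit ball of the gauge; the polynomial form avoids the fourth root.\<close>

definition koranyi_unit_ball :: "(real^3) set" where
  "koranyi_unit_ball = {z. ((z$1)\<^sup>2 + (z$2)\<^sup>2)\<^sup>2 + 16 * (z$3)\<^sup>2 \<le> 1}"

text \<open>The linear part of \<open>z \<mapsto> x * \<delta>\<^sub>r (R z)\<close>, where \<open>R\<close> is the horizontal rotation taking the first
  basis vector to \<open>(c, d)\<close> and \<open>\<delta>\<^sub>r\<close> is the anisotropic dilation.\<close>

definition heis_frame :: "real^3 \<Rightarrow> real \<Rightarrow> real \<Rightarrow> real \<Rightarrow> real^3 \<Rightarrow> real^3" where
  "heis_frame x c d r z = vector
     [r * (c * z$1 - d * z$2), r * (d * z$1 + c * z$2),
      r\<^sup>2 * z$3 + r / 2 * (x$1 * (d * z$1 + c * z$2) - x$2 * (c * z$1 - d * z$2))]"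

lemma linear_heis_frame: "linear (heis_frame x c d r)"
  by (rule linearI) (simp_all add: heis_frame_def vec_eq_iff forall_3 field_simps)

text \<open>The exponent 4 is the homogeneous dimension: two horizontal directions scale by
  \<open>r\<close> and the vertical one by \<open>r^2\<close>, while the shear coming from
  \<open>x\<close> preserves volume.\<close>

lemma det_heis_frame: "det (matrix (heis_frame x c d r)) = r ^ 4 * (c\<^sup>2 + d\<^sup>2)"
  by (simp add: det_3 matrix_def heis_frame_def axis_def) (simp add: field_simps power2_eq_square eval_nat_numeral)

lemma rotation_preserves_sum_squares:
  fixes c d :: real
  assumes "c\<^sup>2 + d\<^sup>2 = 1"
  shows "(c * a - d * b)\<^sup>2 + (d * a + c * b)\<^sup>2 = a\<^sup>2 + b\<^sup>2"
proof -
  have "(c * a - d * b)\<^sup>2 + (d * a + c * b)\<^sup>2 = (c\<^sup>2 + d\<^sup>2) * (a\<^sup>2 + b\<^sup>2)"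
    by (simp add: power2_eq_square algebra_simps)
  then show ?thesis using assms by simp
qed

lemma koranyi_gauge_nonneg: "0 \<le> koranyi_gauge z"
  by (simp add: koranyi_gauge_def)

lemma koranyi_gauge_power4: "koranyi_gauge z ^ 4 = ((z$1)\<^sup>2 + (z$2)\<^sup>2)\<^sup>2 + 16 * (z$3)\<^sup>2"
proof -
  have "koranyi_gauge z ^ 4 = koranyi_gauge z powr 4"
    using koranyi_gauge_nonneg[of z] by (simp add: powr_numeral)
  then show ?thesis by (simp add: koranyi_gauge_def powr_powr)
qed

lemma koranyi_gauge_less_iff:
  "r > 0 \<Longrightarrow> koranyi_gauge z < r \<longleftrightarrow> ((z$1)\<^sup>2 + (z$2)\<^sup>2)\<^sup>2 + 16 * (z$3)\<^sup>2 < r ^ 4"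
  using power_mono_iff[of r "koranyi_gauge z" 4] koranyi_gauge_nonneg[of z]
  by (simp add: koranyi_gauge_power4 flip: not_le)

lemma koranyi_gauge_le_iff:
  "r > 0 \<Longrightarrow> koranyi_gauge z \<le> r \<longleftrightarrow> ((z$1)\<^sup>2 + (z$2)\<^sup>2)\<^sup>2 + 16 * (z$3)\<^sup>2 \<le> r ^ 4"
  using power_mono_iff[of "koranyi_gauge z" r 4] koranyi_gauge_nonneg[of z]
  by (simp add: koranyi_gauge_power4)

lemma koranyi_gauge_minus [simp]: "koranyi_gauge (- z) = koranyi_gauge z"
  by (simp add: koranyi_gauge_def)

lemma heis_dist_commute: "heis_dist x y = heis_dist y x"
proof -
  have "heis_mult (- x) y = - heis_mult (- y) x"
    by (simp add: heis_mult_def vec_eq_iff forall_3) (simp add: field_simps)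
  then show ?thesis by (simp add: heis_dist_def)
qed

lemma open_heis_ball: "r > 0 \<Longrightarrow> open (heis_ball x r)"
  unfolding heis_ball_def heis_dist_def
  by (simp add: koranyi_gauge_less_iff heis_mult_def) (intro open_Collect_less continuous_intros; simp)

lemma centre_in_heis_ball: "r > 0 \<Longrightarrow> x \<in> heis_ball x r"
  by (simp add: heis_ball_def heis_dist_def heis_mult_uminus koranyi_gauge_def)

text \<open>By left invariance \<open>x\<close> drops out, and the horizontal rotation preserves the
  gauge, so only the dilation remains.\<close>

lemma heis_dist_frame:
  assumes "c\<^sup>2 + d\<^sup>2 = 1"
  shows "heis_dist x (x + heis_frame x c d r z) = koranyi_gauge (vector [r * z$1, r * z$2, r\<^sup>2 * z$3])"
proof -
  have "heis_mult (- x) (x + heis_frame x c d r z)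
      = vector [r * (c * z$1 - d * z$2), r * (d * z$1 + c * z$2), r\<^sup>2 * z$3]"
    by (simp add: heis_mult_def heis_frame_def vec_eq_iff forall_3) (simp add: field_simps)
  then show ?thesis
    unfolding heis_dist_def koranyi_gauge_def
    by (simp add: power_mult_distrib rotation_preserves_sum_squares[OF assms] flip: distrib_left)
qed

lemma heis_frame_surj:
  assumes "c\<^sup>2 + d\<^sup>2 = 1" "r > 0"
  obtains z where "y = x + heis_frame x c d r z"
proof -
  have "det (matrix (heis_frame x c d r)) \<noteq> 0" using assms by (simp add: det_heis_frame)
  then have "surj (heis_frame x c d r)"
    by (simp add: det_nz_iff_inj linear_heis_frame linear_injective_imp_surjective)
  then obtain z where "y - x = heis_frame x c d r z" by (meson surjD)
  then show ?thesis using that[of z] by (simp add: algebra_simps)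
qed

lemma koranyi_gauge_dilation:
  assumes "r > 0"
  shows "koranyi_gauge (vector [r * z$1, r * z$2, r\<^sup>2 * z$3]) = r * koranyi_gauge z"
proof -
  have "((r * z$1)\<^sup>2 + (r * z$2)\<^sup>2)\<^sup>2 + 16 * (r\<^sup>2 * z$3)\<^sup>2 
      = r ^ 4 * (((z$1)\<^sup>2 + (z$2)\<^sup>2)\<^sup>2 + 16 * (z$3)\<^sup>2)"
    by (simp add: eval_nat_numeral algebra_simps)
  then have "koranyi_gauge (vector [r * z$1, r * z$2, r\<^sup>2 * z$3]) ^ 4 = (r * koranyi_gauge z) ^ 4"
    by (simp add: koranyi_gauge_power4 power_mult_distrib[of r "koranyi_gauge z"])
  then show ?thesis
    using assms koranyi_gauge_nonneg by (simp add: power_eq_iff_eq_base)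
qed

lemma heis_ball_eq_frame_image:
  assumes "c\<^sup>2 + d\<^sup>2 = 1" "r > 0"
  shows "heis_ball x r = (\<lambda>z. x + heis_frame x c d r z) ` {z. koranyi_gauge z < 1}"
proof -
  have *: "heis_dist x (x + heis_frame x c d r z) < r \<longleftrightarrow> koranyi_gauge z < 1" for z
    using assms by (simp add: heis_dist_frame koranyi_gauge_dilation)
  have "y \<in> (\<lambda>z. x + heis_frame x c d r z) ` {z. koranyi_gauge z < 1}" if "heis_dist x y < r" for y
  proof -
    obtain z where z: "y = x + heis_frame x c d r z" using heis_frame_surj[OF assms] .
    with that * show ?thesis by auto
  qed
  then show ?thesis
    unfolding heis_ball_def using * by auto
qed

lemma koranyi_unit_ball_component_le:
  assumes "z \<in> koranyi_unit_ball"
  shows "\<bar>z$i\<bar> \<le> 1"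
proof -
  have N: "((z$1)\<^sup>2 + (z$2)\<^sup>2)\<^sup>2 + 16 * (z$3)\<^sup>2 \<le> 1"
    using assms by (simp add: koranyi_unit_ball_def)
  have nonneg: "0 \<le> (z$1)\<^sup>2" "0 \<le> (z$2)\<^sup>2" "0 \<le> (z$3)\<^sup>2" "0 \<le> ((z$1)\<^sup>2 + (z$2)\<^sup>2)\<^sup>2"
    by simp_all
  have "((z$1)\<^sup>2 + (z$2)\<^sup>2)\<^sup>2 \<le> 1\<^sup>2" 
    unfolding one_power2 using N nonneg(3) by linarith
  then have "(z$1)\<^sup>2 + (z$2)\<^sup>2 \<le> 1" by (rule power2_le_imp_le) simp
  then have "(z$1)\<^sup>2 \<le> 1" "(z$2)\<^sup>2 \<le> 1" "(z$3)\<^sup>2 \<le> 1"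
    using N nonneg by linarith+
  then show ?thesis using exhaust_3[of i] by (auto simp: abs_square_le_1)
qed

lemma compact_koranyi_unit_ball: "compact koranyi_unit_ball"
proof -
  have "closed koranyi_unit_ball"
    unfolding koranyi_unit_ball_def by (intro closed_Collect_le continuous_intros)
  moreover have "koranyi_unit_ball \<subseteq> cbox (\<chi> i. - 1) (\<chi> i. 1)"
    using koranyi_unit_ball_component_le by (force simp: mem_box_cart abs_le_iff minus_le_iff)
  ultimately show ?thesis
    by (meson bounded_cbox bounded_subset compact_eq_bounded_closed)
qed

lemma closure_koranyi_unit_ball: "closure {z. koranyi_gauge z < 1} = koranyi_unit_ball"
proof
  show "closure {z. koranyi_gauge z < 1} \<subseteq> koranyi_unit_ball"
    using compact_imp_closed[OF compact_koranyi_unit_ball]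
    by (intro closure_minimal) (auto simp: koranyi_unit_ball_def koranyi_gauge_less_iff)
  show "koranyi_unit_ball \<subseteq> closure {z. koranyi_gauge z < 1}"
  proof
    fix z assume z: "z \<in> koranyi_unit_ball"
    \<comment> \<open>Euclidean shrinking by \<open>s n < 1\<close> suffices: the quartic part is
      multiplied by \<open>s n ^ 4\<close> and the vertical part by \<open>(s n)^2\<close>, and both
      factors are at most \<open>(s n)^2 < 1\<close>.\<close>
    define s :: "nat \<Rightarrow> real" where "s n = 1 - inverse (real (Suc n))" for n
    have s: "0 \<le> s n" "s n < 1" for n by (auto simp: s_def field_simps)
    have "s \<longlonglongrightarrow> 1 - 0" unfolding s_def by (intro tendsto_intros LIMSEQ_inverse_real_of_nat)
    then have lim: "(\<lambda>n. s n *\<^sub>R z) \<longlonglongrightarrow> z" using tendsto_scaleR[of s 1 sequentially "\<lambda>_. z" z] by simp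
    have mem: "s n *\<^sub>R z \<in> {z. koranyi_gauge z < 1}" for n
    proof -
      define A where "A = ((z$1)\<^sup>2 + (z$2)\<^sup>2)\<^sup>2" define B where "B = 16 * (z$3)\<^sup>2"
      have AB: "A \<ge> 0" "B \<ge> 0" "A + B \<le> 1" 
        using z by (auto simp: A_def B_def koranyi_unit_ball_def)
      have le: "(s n) ^ 4 \<le> (s n)\<^sup>2" "(s n)\<^sup>2 < 1"
        using s[of n] by (auto intro!: power_decreasing power_less_one_iff[THEN iffD2] simp: power2_less_1_iff abs_less_iff)
      have "((s n * z$1)\<^sup>2 + (s n * z$2)\<^sup>2)\<^sup>2 + 16 * (s n * z$3)\<^sup>2 = (s n) ^ 4 * A + (s n)\<^sup>2 * B"
        by (simp add: A_def B_def eval_nat_numeral algebra_simps)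
      also have "\<dots> \<le> (s n)\<^sup>2 * A + (s n)\<^sup>2 * B"
        using le AB by (intro add_right_mono mult_right_mono) auto
      also have "\<dots> = (s n)\<^sup>2 * (A + B)" by (simp add: algebra_simps)
      also have "\<dots> \<le> (s n)\<^sup>2 * 1" using AB by (intro mult_left_mono) auto
      also have "\<dots> < 1" using le by simp
      finally show ?thesis by (simp add: koranyi_gauge_less_iff)
    qed
    show "z \<in> closure {z. koranyi_gauge z < 1}"
      unfolding closure_sequential using mem lim by (intro exI[of _ "\<lambda>n. s n *\<^sub>R z"]) blast
  qed
qed

text \<open>Injective linear maps and translations commute with closure, so the unit ball determines
  every closed ball. The freedom in \<open>c\<close> and \<open>d\<close> later allows a frame
  aligned with the gradient.\<close>

lemma closure_heis_ball:
  assumes "c\<^sup>2 + d\<^sup>2 = 1" "r > 0"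
  shows "closure (heis_ball x r) = (\<lambda>z. x + heis_frame x c d r z) ` koranyi_unit_ball"
proof -
  have "det (matrix (heis_frame x c d r)) \<noteq> 0" using assms by (simp add: det_heis_frame)
  then have inj: "inj (heis_frame x c d r)"
    by (simp add: det_nz_iff_inj linear_heis_frame)
  have eq: "(\<lambda>z. x + heis_frame x c d r z) ` A = (+) x ` heis_frame x c d r ` A" for A
    by (simp add: image_image)
  show ?thesis
    unfolding heis_ball_eq_frame_image[OF assms] eq closure_translation
      closure_koranyi_unit_ball[symmetric]
    using closure_injective_linear_image[OF linear_heis_frame inj] by simp
qed

lemma heis_dist_le_if_closure_heis_ball:
  assumes "y \<in> closure (heis_ball x r)" "r > 0"
  shows "heis_dist x y \<le> r"
proof -
  obtain z where "y = x + heis_frame x 1 0 r z" "z \<in> koranyi_unit_ball"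
    using assms closure_heis_ball[of 1 0 r x] by auto
  then show ?thesis
    using assms(2) by (simp add: heis_dist_frame koranyi_gauge_dilation koranyi_gauge_le_iff koranyi_unit_ball_def)
qed

lemma compact_closure_heis_ball: "r > 0 \<Longrightarrow> compact (closure (heis_ball x r))"
  unfolding closure_heis_ball[of 1 0, simplified]
  by (intro compact_continuous_image compact_koranyi_unit_ball continuous_intros
      linear_continuous_on linear_conv_bounded_linear[THEN iffD1] linear_heis_frame)

lemma measure_pos_if_open_subset:
  fixes S T :: "'a::euclidean_space set"
  assumes "open T" "T \<noteq> {}" "T \<subseteq> S" "S \<in> lmeasurable"
  shows "measure lebesgue S > 0"
proof -
  have "\<not> negligible S"
    using assms open_not_negligible negligible_subset by blast
  then show ?thesis
    using assms(4) negligible_iff_measure0 by (metis measure_nonneg order_le_less)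
qed

lemma measure_koranyi_unit_ball: "measure lebesgue koranyi_unit_ball > 0"
proof (rule measure_pos_if_open_subset)
  show "open {z::real^3. ((z$1)\<^sup>2 + (z$2)\<^sup>2)\<^sup>2 + 16 * (z$3)\<^sup>2 < 1}"
    by (intro open_Collect_less continuous_intros)
  have "0 \<in> {z::real^3. ((z$1)\<^sup>2 + (z$2)\<^sup>2)\<^sup>2 + 16 * (z$3)\<^sup>2 < 1}" by simp
  then show "{z::real^3. ((z$1)\<^sup>2 + (z$2)\<^sup>2)\<^sup>2 + 16 * (z$3)\<^sup>2 < 1} \<noteq> {}" by blast
qed (auto simp: koranyi_unit_ball_def lmeasurable_compact[OF compact_koranyi_unit_ball, unfolded koranyi_unit_ball_def])

lemma measure_closure_heis_ball:
  assumes "r > 0"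
  shows "measure lebesgue (closure (heis_ball x r)) > 0"
  using assms centre_in_heis_ball
  by (intro measure_pos_if_open_subset[OF open_heis_ball _ closure_subset]
      lmeasurable_compact compact_closure_heis_ball) auto

section \<open>Moments of the unit ball\<close>

lemma integral_koranyi_unit_ball_linear:
  fixes g :: "real^3 \<Rightarrow> real^3" and f :: "real^3 \<Rightarrow> real"
  assumes "linear g" "\<bar>det (matrix g)\<bar> = 1" "g ` koranyi_unit_ball = koranyi_unit_ball"
    and "continuous_on koranyi_unit_ball f"
  shows "(LINT z|lebesgue_on koranyi_unit_ball. f (g z)) = (LINT z|lebesgue_on koranyi_unit_ball. f z)"
  using integral_affine_image_compact(2)[of g koranyi_unit_ball 0 f] assms compact_koranyi_unit_ball
  by simp

text \<open>A sign change of coordinates is an involution of determinant 1 or -1 that preserves the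
  polynomial defining the ball; it need not be a group automorphism.\<close>

lemma integral_koranyi_unit_ball_reflect:
  fixes f :: "real^3 \<Rightarrow> real"
  assumes s: "\<bar>s1\<bar> = 1" "\<bar>s2\<bar> = 1" "\<bar>s3\<bar> = 1" and f: "continuous_on koranyi_unit_ball f"
  shows "(LINT z|lebesgue_on koranyi_unit_ball. f (vector [s1 * z$1, s2 * z$2, s3 * z$3]))
    = (LINT z|lebesgue_on koranyi_unit_ball. f z)"
proof (rule integral_koranyi_unit_ball_linear[OF _ _ _ f])
  let ?g = "\<lambda>z::real^3. vector [s1 * z$1, s2 * z$2, s3 * z$3] :: real^3"
  show "linear ?g"
    by (rule linearI) (simp_all add: vec_eq_iff forall_3 algebra_simps)
  show "\<bar>det (matrix ?g)\<bar> = 1"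
    using s by (simp add: det_3 matrix_def axis_def abs_mult)
  have sq: "s1\<^sup>2 = 1" "s2\<^sup>2 = 1" "s3\<^sup>2 = 1" using s by (simp_all add: abs_square_eq_1)
  have mem: "?g z \<in> koranyi_unit_ball \<longleftrightarrow> z \<in> koranyi_unit_ball" for z
    using sq by (simp add: koranyi_unit_ball_def power_mult_distrib)
  have inv: "?g (?g z) = z" for z
    using sq by (simp add: vec_eq_iff forall_3 power2_eq_square flip: mult.assoc)
  show "?g ` koranyi_unit_ball = koranyi_unit_ball"
  proof (intro equalityI subsetI)
    fix z assume "z \<in> koranyi_unit_ball"
    then have "?g (?g z) \<in> ?g ` koranyi_unit_ball" using mem by (intro imageI) blast
    then show "z \<in> ?g ` koranyi_unit_ball" by (simp only: inv)
  qed (use mem in blast)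
qed

text \<open>\<open>heis_frame 0 c d 1\<close> is a rotation about the vertical axis. It preserves
  the ball because every frame at the origin with \<open>r = 1\<close> parametrizes the same closed
  ball.\<close>

lemma integral_koranyi_unit_ball_rotate:
  fixes f :: "real^3 \<Rightarrow> real"
  assumes cd: "c\<^sup>2 + d\<^sup>2 = 1" and f: "continuous_on koranyi_unit_ball f"
  shows "(LINT z|lebesgue_on koranyi_unit_ball. f (heis_frame 0 c d 1 z))
    = (LINT z|lebesgue_on koranyi_unit_ball. f z)"
proof (rule integral_koranyi_unit_ball_linear[OF linear_heis_frame _ _ f])
  show "\<bar>det (matrix (heis_frame 0 c d 1))\<bar> = 1"
    using cd by (simp add: det_heis_frame)
  have "heis_frame 0 1 0 1 z = z" for z
    by (simp add: heis_frame_def vec_eq_iff forall_3)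
  then show "heis_frame 0 c d 1 ` koranyi_unit_ball = koranyi_unit_ball"
    using closure_heis_ball[of c d 1 0] closure_heis_ball[of 1 0 1 0] cd by simp
qed

section \<open>Vanishing moments and the ratio of the second moments\<close>

lemma integral_spow_odd:
  assumes "p \<ge> 2"
  shows "(LINT z|lebesgue_on koranyi_unit_ball. spow p (k * z$1)) = 0"
  using integral_koranyi_unit_ball_reflect[of "-1" 1 1 "\<lambda>z. spow p (k * z$1)"] assms
  by (simp add: continuous_intros)

text \<open>Each integrand changes sign under a reflection of \<open>z$2\<close> or of
  \<open>z$3\<close>.\<close>

lemma integral_dspow_cross:
  assumes "p \<ge> 2"
  shows "(LINT z|lebesgue_on koranyi_unit_ball. dspow p (z$1) * (z$1 * z$2)) = 0"
    and "(LINT z|lebesgue_on koranyi_unit_ball. dspow p (z$1) * z$3) = 0"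
    and "(LINT z|lebesgue_on koranyi_unit_ball. spow p (z$1) * z$2) = 0"
  using integral_koranyi_unit_ball_reflect[of 1 "-1" 1 "\<lambda>z. dspow p (z$1) * (z$1 * z$2)"] assms
    integral_koranyi_unit_ball_reflect[of 1 1 "-1" "\<lambda>z. dspow p (z$1) * z$3"]
    integral_koranyi_unit_ball_reflect[of 1 "-1" 1 "\<lambda>z. spow p (z$1) * z$2"]
  by (simp_all add: continuous_intros)

lemma abs_mult_le_one: "\<bar>a * b\<bar> \<le> 1" if "\<bar>a\<bar> \<le> 1" "\<bar>b\<bar> \<le> 1" for a b :: real
  unfolding abs_mult using that by (intro mult_le_one) auto

text \<open>The rotated integrals of \<open>spow p (z$1) * z$2\<close> do not depend on the angle \<open>t\<close>; the identity is
  their derivative at \<open>t = 0\<close>.\<close>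

lemma integral_dspow_transverse:
  assumes p: "p \<ge> 2"
  shows "(LINT z|lebesgue_on koranyi_unit_ball. dspow p (z$1) * (z$2)\<^sup>2)
    = (LINT z|lebesgue_on koranyi_unit_ball. spow p (z$1) * z$1)"
proof -
  let ?K = "koranyi_unit_ball"
  \<comment> \<open>\<open>w\<close> and \<open>v\<close> are the horizontal coordinates of
    \<open>z\<close> rotated by \<open>t\<close>. Their derivatives in \<open>t\<close> are
    \<open>- v\<close> and \<open>w\<close>, which makes \<open>F'\<close> the derivative of
    \<open>F\<close>.\<close>
  define w v where "w z t = z$1 * cos t - z$2 * sin t" and "v z t = z$1 * sin t + z$2 * cos t"
    for z :: "real^3" and t :: real
  define F where "F z t = spow p (w z t) * v z t" for z t
  define F' where "F' z t = spow p (w z t) * w z t - dspow p (w z t) * (v z t)\<^sup>2" for z t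
  have cw: "continuous_on A (\<lambda>z. w z t)" "continuous_on A (\<lambda>z. v z t)" for A t
    unfolding w_def v_def by (intro continuous_intros)+
  have cont: "continuous_on ?K (\<lambda>z. F z t)" "continuous_on ?K (\<lambda>z. F' z t)" for t
    unfolding F_def F'_def by (intro continuous_intros cw p)+
  note int = cont[THEN integrable_lebesgue_on_compact[OF compact_koranyi_unit_ball]]
  have F0: "(LINT z|lebesgue_on ?K. F z t) = 0" for t
  proof -
    have "(LINT z|lebesgue_on ?K. F z t)
        = (LINT z|lebesgue_on ?K. (\<lambda>z. spow p (z$1) * z$2) (heis_frame 0 (cos t) (sin t) 1 z))"
      unfolding F_def w_def v_def heis_frame_def by (simp add: algebra_simps)
    also have "\<dots> = (LINT z|lebesgue_on ?K. spow p (z$1) * z$2)"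
      by (rule integral_koranyi_unit_ball_rotate) (auto intro!: continuous_intros p)
    finally show ?thesis using integral_dspow_cross(3)[OF p] by simp
  qed
  have der: "(F z has_real_derivative F' z t) (at t)" for z t
  proof -
    have "(w z has_real_derivative - v z t) (at t)" "(v z has_real_derivative w z t) (at t)"
      unfolding w_def [abs_def] v_def [abs_def]
      by (auto intro!: derivative_eq_intros simp: w_def v_def)
    from DERIV_mult[OF DERIV_chain2[OF spow_DERIV[OF p] this(1)] this(2)]
    show ?thesis unfolding F_def [abs_def] F'_def
      by (simp add: algebra_simps power2_eq_square)
  qed
  have bound: "\<bar>F' z t\<bar> \<le> spow p 2 * 2 + dspow p 2 * 4" if "z \<in> ?K" for z t
  proof -
    have "\<bar>z$i * cos t\<bar> \<le> 1" "\<bar>z$i * sin t\<bar> \<le> 1" for i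
      using koranyi_unit_ball_component_le[OF that] by (intro abs_mult_le_one; simp)+
    from this[of 1] this[of 2] have wv: "\<bar>w z t\<bar> \<le> 2" "\<bar>v z t\<bar> \<le> 2"
      unfolding w_def v_def by linarith+
    have "\<bar>spow p (w z t)\<bar> * \<bar>w z t\<bar> \<le> spow p 2 * 2"
      using wv abs_spow_le[OF p wv(1)] by (intro mult_mono) auto
    moreover have "\<bar>dspow p (w z t)\<bar> * (v z t)\<^sup>2 \<le> dspow p 2 * 4"
      using wv(2) abs_dspow_le[OF p wv(1)] abs_le_square_iff[of "v z t" 2] by (intro mult_mono) auto
    ultimately show ?thesis
      unfolding F'_def using abs_triangle_ineq4[of "spow p (w z t) * w z t" "dspow p (w z t) * (v z t)\<^sup>2"]
      by (simp add: abs_mult)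
  qed
  \<comment> \<open>By the mean value theorem each difference quotient is a value of
    \<open>F'\<close>, so the bound on \<open>F'\<close> dominates the sequence and the limit passes
    under the integral.\<close>
  let ?t = "\<lambda>n::nat. inverse (real (Suc n))"
  have lim: "(\<lambda>n. LINT z|lebesgue_on ?K. (F z (?t n) - F z 0) / ?t n) \<longlonglongrightarrow> (LINT z|lebesgue_on ?K. F' z 0)"
  proof (rule integral_dominated_convergence[where w = "\<lambda>_. spow p 2 * 2 + dspow p 2 * 4"])
    show "(\<lambda>z. F' z 0) \<in> borel_measurable (lebesgue_on ?K)"
      "(\<lambda>z. (F z (?t n) - F z 0) / ?t n) \<in> borel_measurable (lebesgue_on ?K)" for n
      using int by (auto intro!: borel_measurable_divide borel_measurable_diff)
    interpret finite_measure "lebesgue_on ?K"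
      by (intro finite_measure_lebesgue_on lmeasurable_compact compact_koranyi_unit_ball)
    show "integrable (lebesgue_on ?K) (\<lambda>_. spow p 2 * 2 + dspow p 2 * 4)" by simp
    have "(\<lambda>h. (F z (0 + h) - F z 0) / h) \<midarrow>0\<rightarrow> F' z 0" for z
      using der[of z 0] by (simp add: DERIV_def)
    then show "AE z in lebesgue_on ?K. (\<lambda>n. (F z (?t n) - F z 0) / ?t n) \<longlonglongrightarrow> F' z 0"
      using LIMSEQ_inverse_real_of_nat by (auto intro!: AE_I2 simp: LIMSEQ_SEQ_conv[symmetric])
    fix n
    have "\<bar>(F z (?t n) - F z 0) / ?t n\<bar> \<le> spow p 2 * 2 + dspow p 2 * 4" if "z \<in> ?K" for z
    proof -
      have "0 < ?t n" by simp
      from MVT2[OF this der[of z]] obtain s where "F z (?t n) - F z 0 = (?t n - 0) * F' z s" by blast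
      then have "(F z (?t n) - F z 0) / ?t n = F' z s" by (simp add: field_simps)
      then show ?thesis using bound[OF that] by simp
    qed
    then show "AE z in lebesgue_on ?K. norm ((F z (?t n) - F z 0) / ?t n) \<le> spow p 2 * 2 + dspow p 2 * 4"
      by (intro AE_I2) simp
  qed
  have "(LINT z|lebesgue_on ?K. (F z (?t n) - F z 0) / ?t n) = 0" for n
    using int F0 by (simp add: Bochner_Integration.integral_diff)
  with lim have "(LINT z|lebesgue_on ?K. F' z 0) = 0"
    by (simp add: LIMSEQ_const_iff)
  moreover have "integrable (lebesgue_on ?K) (\<lambda>z. spow p (z$1) * z$1)" 
    "integrable (lebesgue_on ?K) (\<lambda>z. dspow p (z$1) * (z$2)\<^sup>2)"
    by (intro integrable_lebesgue_on_compact compact_koranyi_unit_ball continuous_intros p)+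
  ultimately show ?thesis by (simp add: F'_def w_def v_def)
qed

text \<open>The integrand is nonnegative and vanishes only on the null set \<open>z$1 = 0\<close>,
  while the ball has positive measure.\<close>

lemma integral_spow_moment_pos:
  assumes p: "p \<ge> 2"
  shows "(LINT z|lebesgue_on koranyi_unit_ball. spow p (z$1) * z$1) > 0"
proof -
  let ?K = "koranyi_unit_ball"
  have K: "?K \<in> lmeasurable" by (rule lmeasurable_compact[OF compact_koranyi_unit_ball])
  have pos: "spow p s * s > 0" if "s \<noteq> 0" for s
    using that spow_pos[of s p] spow_pos[of "- s" p] by (cases "s > 0") (auto simp: mult_neg_neg)
  then have nn: "spow p s * s \<ge> 0" for s by (cases "s = 0") (auto simp: less_imp_le)
  have int: "integrable (lebesgue_on ?K) (\<lambda>z. spow p (z$1) * z$1)"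
    by (intro integrable_lebesgue_on_compact compact_koranyi_unit_ball continuous_intros p)
  have "(LINT z|lebesgue_on ?K. spow p (z$1) * z$1) \<noteq> 0"
  proof
    assume "(LINT z|lebesgue_on ?K. spow p (z$1) * z$1) = 0"
    then have "AE z in lebesgue_on ?K. spow p (z$1) * z$1 = 0"
      using integral_nonneg_eq_0_iff_AE[OF int] nn by simp
    then have "AE z in lebesgue_on ?K. z$1 = 0"
      by eventually_elim (use pos in force)
    then have "AE z in lebesgue. z \<in> ?K \<longrightarrow> z$1 = 0"
      using K by (subst (asm) AE_restrict_space_iff) auto
    moreover have "AE z in lebesgue. z \<notin> {z::real^3. axis 1 1 \<bullet> z = 0}"
      using negligible_hyperplane[of "axis 1 1 :: real^3" 0] 
      by (intro AE_not_in) (simp add: negligible_iff_null_sets)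
    ultimately have "AE z in lebesgue. z \<notin> ?K"
      by eventually_elim (auto simp: inner_axis')
    then have "negligible ?K"
      using K by (simp add: negligible_iff_null_sets AE_iff_null_sets fmeasurableD)
    then show False
      using measure_koranyi_unit_ball negligible_iff_measure by force
  qed
  moreover have "(LINT z|lebesgue_on ?K. spow p (z$1) * z$1) \<ge> 0"
    by (intro integral_nonneg_AE AE_I2 nn)
  ultimately show ?thesis by simp
qed

section \<open>Taylor expansion along dilations\<close>

lemma has_derivative_along_line:
  fixes f :: "'a::real_normed_vector \<Rightarrow> real"
  assumes f': "(f has_derivative f') (at x)"
  shows "((\<lambda>t. f (x + t *\<^sub>R v)) has_real_derivative f' v) (at 0)"
proof -
  have "((\<lambda>t. x + t *\<^sub>R v) has_derivative (\<lambda>t. t *\<^sub>R v)) (at (0::real))"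
    by (auto intro!: derivative_eq_intros)
  moreover have "(f has_derivative f') (at (x + 0 *\<^sub>R v))" using f' by simp
  ultimately have "((\<lambda>t. f (x + t *\<^sub>R v)) has_derivative (\<lambda>t. f' (t *\<^sub>R v))) (at 0)"
    by (rule has_derivative_compose[of "\<lambda>t. x + t *\<^sub>R v"])
  moreover have "f' (t *\<^sub>R v) = f' v * t" for t
    using linear_cmul[OF has_derivative_linear[OF f']] by simp
  ultimately show ?thesis by (simp add: has_field_derivative_def)
qed

lemma partial_DERIV:
  assumes "f differentiable (at x)"
  shows "((\<lambda>t. f (x + t *\<^sub>R axis i 1)) has_real_derivative partial i f x) (at 0)"
proof -
  obtain f' where f': "(f has_derivative f') (at x)" using assms by (auto simp: differentiable_def)
  note D = has_derivative_along_line[OF f', of "axis i 1"]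
  show ?thesis unfolding partial_def DERIV_imp_deriv[OF D] by (rule D)
qed

lemma has_derivative_partial:
  assumes "f differentiable (at x)"
  shows "(f has_derivative (\<lambda>h. h$1 * partial 1 f x + h$2 * partial 2 f x + h$3 * partial 3 f x)) (at x)"
proof -
  obtain f' where f': "(f has_derivative f') (at x)" using assms by (auto simp: differentiable_def)
  have partial: "partial i f x = f' (axis i 1)" for i
    unfolding partial_def by (rule DERIV_imp_deriv[OF has_derivative_along_line[OF f']])
  have "f' = (\<lambda>h. h$1 * partial 1 f x + h$2 * partial 2 f x + h$3 * partial 3 f x)"
  proof
    fix h :: "real^3"
    have "h = h$1 *\<^sub>R axis 1 1 + h$2 *\<^sub>R axis 2 1 + h$3 *\<^sub>R axis 3 1"
      by (simp add: vec_eq_iff forall_3 axis_def)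
    then have "f' h = f' (h$1 *\<^sub>R axis 1 1 + h$2 *\<^sub>R axis 2 1 + h$3 *\<^sub>R axis 3 1)" by simp
    then show "f' h = h$1 * partial 1 f x + h$2 * partial 2 f x + h$3 * partial 3 f x"
      using has_derivative_linear[OF f'] by (simp add: linear_add linear_cmul partial)
  qed
  with f' show ?thesis by simp
qed

text \<open>The terms with \<open>axis k 1\<close> come from differentiating the coefficients
  \<open>x$2\<close> and \<open>x$1\<close> of the horizontal fields.\<close>

lemma partial_horiz:
  assumes "\<And>j. partial j U differentiable (at x)"
  shows "partial k (horiz 1 U) x
      = partial k (partial 1 U) x - axis k 1 $ 2 / 2 * partial 3 U x - x$2 / 2 * partial k (partial 3 U) x"
    and "partial k (horiz 2 U) x
      = partial k (partial 2 U) x + axis k 1 $ 1 / 2 * partial 3 U x + x$1 / 2 * partial k (partial 3 U) x"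
proof -
  note D = partial_DERIV[OF assms]
  show "partial k (horiz 1 U) x
      = partial k (partial 1 U) x - axis k 1 $ 2 / 2 * partial 3 U x - x$2 / 2 * partial k (partial 3 U) x"
    unfolding partial_def[of k "horiz 1 U"]
    by (rule DERIV_imp_deriv) (auto simp: horiz_def algebra_simps intro!: derivative_eq_intros D)
  show "partial k (horiz 2 U) x
      = partial k (partial 2 U) x + axis k 1 $ 1 / 2 * partial 3 U x + x$1 / 2 * partial k (partial 3 U) x"
    unfolding partial_def[of k "horiz 2 U"]
    by (rule DERIV_imp_deriv) (auto simp: horiz_def algebra_simps intro!: derivative_eq_intros D)
qed

section \<open>Derivatives along dilation curves\<close>

text \<open>Coordinate \<open>i\<close> of the velocity at \<open>s\<close> of the curve
  \<open>x + heis_frame x c d s z\<close>. The term \<open>2 * s * z$3\<close> arises because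
  dilations act quadratically on the vertical coordinate.\<close>

definition frame_velocity :: "real^3 \<Rightarrow> real \<Rightarrow> real \<Rightarrow> real^3 \<Rightarrow> real \<Rightarrow> 3 \<Rightarrow> real" where
  "frame_velocity x c d z s i =
     (if i = 1 then c * z$1 - d * z$2 else if i = 2 then d * z$1 + c * z$2
      else (x$1 * (d * z$1 + c * z$2) - x$2 * (c * z$1 - d * z$2)) / 2 + 2 * s * z$3)"

text \<open>The second derivative of \<open>U\<close> along the same curve; the last summand is the
  contribution of its constant vertical acceleration \<open>2 * z$3\<close>.\<close>

definition frame_second_deriv ::
  "(real^3 \<Rightarrow> real) \<Rightarrow> real^3 \<Rightarrow> real \<Rightarrow> real \<Rightarrow> real^3 \<Rightarrow> real \<Rightarrow> real" where
  "frame_second_deriv U x c d z s =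
     (\<Sum>i\<in>UNIV. \<Sum>j\<in>UNIV. frame_velocity x c d z s i * frame_velocity x c d z s j
        * partial j (partial i U) (x + heis_frame x c d s z))
     + 2 * z$3 * partial 3 U (x + heis_frame x c d s z)"

lemma DERIV_along_frame:
  assumes "f differentiable (at (x + heis_frame x c d s z))"
  shows "((\<lambda>s. f (x + heis_frame x c d s z)) has_real_derivative
    (\<Sum>i\<in>UNIV. frame_velocity x c d z s i * partial i f (x + heis_frame x c d s z))) (at s)"
proof -
  have "(\<lambda>s. x + heis_frame x c d s z) = (\<lambda>s. x
      + s *\<^sub>R vector [c * z$1 - d * z$2, d * z$1 + c * z$2,
          (x$1 * (d * z$1 + c * z$2) - x$2 * (c * z$1 - d * z$2)) / 2]
      + s\<^sup>2 *\<^sub>R vector [0, 0, z$3])"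
    by (simp add: fun_eq_iff heis_frame_def vec_eq_iff forall_3)
  moreover have "(\<chi> i. frame_velocity x c d z s i) =
      vector [c * z$1 - d * z$2, d * z$1 + c * z$2,
        (x$1 * (d * z$1 + c * z$2) - x$2 * (c * z$1 - d * z$2)) / 2] + (2 * s) *\<^sub>R vector [0, 0, z$3]"
    by (simp add: vec_eq_iff forall_3 frame_velocity_def)
  ultimately have "((\<lambda>s. x + heis_frame x c d s z) has_derivative
      (\<lambda>t. t *\<^sub>R (\<chi> i. frame_velocity x c d z s i))) (at s)"
    by (auto intro!: derivative_eq_intros simp: algebra_simps)
  from has_derivative_compose[OF this has_derivative_partial[OF assms]]
  show ?thesis
    unfolding has_field_derivative_def
    by (rule has_derivative_eq_rhs) (simp add: sum_3 fun_eq_iff algebra_simps)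
qed

text \<open>One-variable Taylor formula with Lagrange remainder along the dilation curve. The curve
  leaves \<open>x\<close> with horizontal velocity, so the first-order term sees only the horizontal
  gradient.\<close>

lemma frame_second_order_Taylor:
  assumes S: "open S" and U: "Ck_on 2 U S" and r: "r > 0"
    and in_S: "\<And>s. 0 \<le> s \<Longrightarrow> s \<le> r \<Longrightarrow> x + heis_frame x c d s z \<in> S"
  shows "\<exists>s. 0 < s \<and> s < r \<and> U (x + heis_frame x c d r z) =
    U x + r * ((c * z$1 - d * z$2) * horiz 1 U x + (d * z$1 + c * z$2) * horiz 2 U x)
    + r\<^sup>2 / 2 * frame_second_deriv U x c d z s"
proof -
  let ?y = "\<lambda>s. x + heis_frame x c d s z"
  let ?a = "frame_velocity x c d z"
  define D where "D n s = (if n = 0 then U (?y s) else if n = 1 then \<Sum>i\<in>UNIV. ?a s i * partial i U (?y s)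
    else frame_second_deriv U x c d z s)" for n :: nat and s
  have diff: "U differentiable (at y)" "partial i U differentiable (at y)" if "y \<in> S" for y i
    using U that S by (auto simp: numeral_2_eq_2 differentiable_on_eq_differentiable_at)
  have der: "(D n has_real_derivative D (Suc n) s) (at s)" if n: "n < 2" and s: "0 \<le> s" "s \<le> r" for n s
  proof (cases "n = 0")
    case True
    then show ?thesis
      using DERIV_along_frame[OF diff(1)[OF in_S[OF s]]] by (simp add: D_def [abs_def])
  next
    case False
    then have n: "n = 1" using n by simp
    have a: "((\<lambda>s. ?a s i) has_real_derivative (if i = 3 then 2 * z$3 else 0)) (at s)" for i
      using exhaust_3[of i] by (auto simp: frame_velocity_def intro!: derivative_eq_intros)
    have "((\<lambda>s. \<Sum>i\<in>UNIV. ?a s i * partial i U (?y s)) has_real_derivative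
       (\<Sum>i\<in>UNIV. (if i = 3 then 2 * z$3 else 0) * partial i U (?y s) +
          (\<Sum>j\<in>UNIV. ?a s j * partial j (partial i U) (?y s)) * ?a s i)) (at s)"
      by (intro DERIV_sum DERIV_mult a DERIV_along_frame diff in_S s)
    also have "(\<Sum>i\<in>UNIV. (if i = 3 then 2 * z$3 else 0) * partial i U (?y s) +
          (\<Sum>j\<in>UNIV. ?a s j * partial j (partial i U) (?y s)) * ?a s i) = frame_second_deriv U x c d z s"
      by (simp add: frame_second_deriv_def sum_3 algebra_simps)
    finally show ?thesis by (simp add: D_def [abs_def] n)
  qed
  have D0: "D 0 = (\<lambda>s. U (?y s))" by (simp add: D_def fun_eq_iff)
  have "\<exists>s>0. s < r \<and> U (?y r) = (\<Sum>m<2. D m 0 / fact m * r ^ m) + D 2 s / fact 2 * r ^ 2"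
    using der by (intro Maclaurin[where f = "\<lambda>s. U (?y s)"] r D0) auto
  then obtain s where s: "0 < s" "s < r" "U (?y r) = (\<Sum>m<2. D m 0 / fact m * r ^ m) + D 2 s / fact 2 * r ^ 2"
    by blast
  have y0: "?y 0 = x" by (simp add: heis_frame_def vec_eq_iff forall_3)
  have "D 1 0 = (c * z$1 - d * z$2) * horiz 1 U x + (d * z$1 + c * z$2) * horiz 2 U x"
    by (simp add: D_def y0 sum_3 frame_velocity_def horiz_def field_simps)
  moreover have "U (?y r) = D 0 0 + r * D 1 0 + r\<^sup>2 / 2 * D 2 s"
    using s(3) by (simp add: lessThan_nat_numeral)
  moreover have "D 0 0 = U x" "D 2 s = frame_second_deriv U x c d z s"
    by (simp_all add: D_def y0)
  ultimately show ?thesis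
    using s(1,2) by (intro exI[of _ s]) simp
qed

text \<open>At \<open>s = 0\<close> the velocity is horizontal. The first-order terms in
  \<open>partial 3 U\<close> produced by the two orders of \<open>horiz 1\<close> and
  \<open>horiz 2\<close> are opposite and cancel in the sum; only the acceleration term is
  left.\<close>

lemma frame_second_deriv_0:
  assumes "\<And>j. partial j U differentiable (at x)"
  defines "a1 \<equiv> \<lambda>c d z. c * z$1 - d * z$2" and "a2 \<equiv> \<lambda>c d z. d * z$1 + c * z$2"
  shows "frame_second_deriv U x c d z 0 =
    (a1 c d z)\<^sup>2 * horiz 1 (horiz 1 U) x + (a2 c d z)\<^sup>2 * horiz 2 (horiz 2 U) x
    + a1 c d z * a2 c d z * (horiz 1 (horiz 2 U) x + horiz 2 (horiz 1 U) x) + 2 * z$3 * partial 3 U x"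
proof -
  have y0: "x + heis_frame x c d 0 z = x" by (simp add: heis_frame_def vec_eq_iff forall_3)
  show ?thesis
    unfolding frame_second_deriv_def y0 sum_3 frame_velocity_def
    by (simp add: horiz_def[of _ "horiz _ U"] partial_horiz[OF assms(1)] axis_def a1_def a2_def)
      (simp add: field_simps power2_eq_square)
qed

lemma heis_frame_axis:
  "heis_frame x c d r z = (r * (c * z$1 - d * z$2)) *\<^sub>R axis 1 1 + (r * (d * z$1 + c * z$2)) *\<^sub>R axis 2 1
    + (r\<^sup>2 * z$3 + r / 2 * (x$1 * (d * z$1 + c * z$2) - x$2 * (c * z$1 - d * z$2))) *\<^sub>R axis 3 1"
  by (simp add: heis_frame_def vec_eq_iff forall_3 axis_def)

lemma continuous_on_heis_frame:
  "continuous_on A (\<lambda>(x, c, d, z, s). x + heis_frame x c d s z)"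
  unfolding heis_frame_axis split_beta by (intro continuous_intros; simp)

lemma continuous_on_frame_velocity:
  "continuous_on A (\<lambda>(x, c, d, z, s). frame_velocity x c d z s i)"
  unfolding frame_velocity_def split_beta
  by (cases "i = 1"; cases "i = 2") (simp_all, (intro continuous_intros; simp)+)

text \<open>Continuity is joint in all five variables because the later limit moves base point,
  rotation and parameter at once, and the bound is taken over a compact set of them.\<close>

lemma continuous_on_frame_second_deriv:
  assumes "Ck_on 2 U S"
  shows "continuous_on {(x, c, d, z, s). x + heis_frame x c d s z \<in> S}
    (\<lambda>(x, c, d, z, s). frame_second_deriv U x c d z s)"
proof -
  let ?W = "{(x, c, d, z, s). x + heis_frame x c d s z \<in> S}"
  have c: "continuous_on S (partial i U)" "continuous_on S (partial j (partial i U))" for i j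
    using assms by (auto simp: numeral_2_eq_2 differentiable_imp_continuous_on)
  have comp: "continuous_on ?W (\<lambda>(x, c, d, z, s). f (x + heis_frame x c d s z))"
    if "continuous_on S f" for f :: "real^3 \<Rightarrow> real"
    unfolding split_beta
    by (rule continuous_on_compose2[OF that continuous_on_heis_frame[unfolded split_beta]])
      (auto simp: split_beta)
  have v: "continuous_on ?W (\<lambda>w. case w of (x, c, d, z, s) \<Rightarrow> z $ 3)"
    unfolding split_beta by (intro continuous_intros)
  show ?thesis
    using continuous_on_frame_velocity[of ?W] comp[OF c(1)] comp[OF c(2)] v
    unfolding frame_second_deriv_def split_beta
    by (intro continuous_intros) auto
qed

text \<open>The factor \<open>s\<close> gives smallness uniformly on bounded sets. In the constant,
  2 + 2 + 1 bounds the two horizontal entries and the dilation part of the vertical one, and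
  \<open>2 * norm x\<close> bounds the shear.\<close>

lemma norm_heis_frame_le:
  assumes "\<bar>c\<bar> \<le> 1" "\<bar>d\<bar> \<le> 1" "0 \<le> s" "s \<le> 1" "z \<in> koranyi_unit_ball"
  shows "norm (heis_frame x c d s z) \<le> s * (5 + 2 * norm x)"
proof -
  have z: "\<bar>a * z$i\<bar> \<le> 1" if "\<bar>a\<bar> \<le> 1" for a i
    using koranyi_unit_ball_component_le[OF assms(5)] that by (intro abs_mult_le_one)
  define a b where "a = c * z$1 - d * z$2" and "b = d * z$1 + c * z$2"
  have ab: "\<bar>a\<bar> \<le> 2" "\<bar>b\<bar> \<le> 2"
    unfolding a_def b_def using z[OF assms(1), of 1] z[OF assms(1), of 2] z[OF assms(2), of 1] z[OF assms(2), of 2] by linarith+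
  have "\<bar>x$1 * b - x$2 * a\<bar> \<le> \<bar>x$1\<bar> * \<bar>b\<bar> + \<bar>x$2\<bar> * \<bar>a\<bar>"
    unfolding abs_mult[symmetric] by (rule abs_triangle_ineq4)
  also have "\<dots> \<le> norm x * 2 + norm x * 2"
    using ab by (intro add_mono mult_mono component_le_norm_cart) auto
  finally have c: "\<bar>(x$1 * b - x$2 * a) / 2\<bar> \<le> 2 * norm x" by simp
  have "heis_frame x c d s z = s *\<^sub>R vector [a, b, s * z$3 + (x$1 * b - x$2 * a) / 2]"
    by (simp add: heis_frame_def a_def b_def vec_eq_iff forall_3 power2_eq_square algebra_simps
        add_divide_distrib diff_divide_distrib)
  then have "norm (heis_frame x c d s z) = s * norm (vector [a, b, s * z$3 + (x$1 * b - x$2 * a) / 2] :: real^3)"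
    using assms by simp
  also have "\<dots> \<le> s * (\<bar>a\<bar> + \<bar>b\<bar> + \<bar>s * z$3 + (x$1 * b - x$2 * a) / 2\<bar>)"
    using norm_le_l1_cart[of "vector [a, b, s * z$3 + (x$1 * b - x$2 * a) / 2] :: real^3"] assms
    by (intro mult_left_mono) (auto simp: sum_3)
  also have "\<dots> \<le> s * (2 + 2 + (1 + 2 * norm x))"
    using ab c z[of s 3] assms by (intro mult_left_mono add_mono order_trans[OF abs_triangle_ineq]) auto
  finally show ?thesis by simp
qed

section \<open>The linearized mean\<close>

lemma spow_mean_value:
  assumes "p \<ge> 2"
  shows "\<exists>\<xi>. \<bar>\<xi> - a\<bar> \<le> \<bar>h\<bar> \<and> spow p (a + h) - spow p a = dspow p \<xi> * h"
proof -
  consider "h = 0" | "h > 0" | "h < 0" by linarith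
  then show ?thesis
  proof cases
    case 1 then show ?thesis by (intro exI[of _ a]) simp
  next
    case 2
    then obtain z where "a < z" "z < a + h" "spow p (a + h) - spow p a = (a + h - a) * dspow p z"
      using MVT2[of a "a + h" "spow p" "dspow p"] spow_DERIV[OF assms] by auto
    then show ?thesis by (intro exI[of _ z]) (auto simp: mult.commute)
  next
    case 3
    then obtain z where "a + h < z" "z < a" "spow p a - spow p (a + h) = (a - (a + h)) * dspow p z"
      using MVT2[of "a + h" a "spow p" "dspow p"] spow_DERIV[OF assms] by auto
    then show ?thesis by (intro exI[of _ z]) (auto simp: algebra_simps)
  qed
qed

text \<open>The base point \<open>a n\<close> moves with \<open>n\<close>, so differentiability at
  \<open>a0\<close> alone does not suffice; the mean value points tend to \<open>a0\<close> and
  continuity of \<open>dspow p\<close> concludes.\<close>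

lemma spow_difference_quotient_tendsto:
  assumes p: "p \<ge> 2" and a: "a \<longlonglongrightarrow> a0" and r: "r \<longlonglongrightarrow> 0" and h: "h \<longlonglongrightarrow> h0"
    and pos: "\<And>n. r n > (0::real)"
  shows "(\<lambda>n. (spow p (a n + r n * h n) - spow p (a n)) / r n) \<longlonglongrightarrow> dspow p a0 * h0"
proof -
  have "\<forall>n. \<exists>\<xi>. \<bar>\<xi> - a n\<bar> \<le> \<bar>r n * h n\<bar> \<and>
      spow p (a n + r n * h n) - spow p (a n) = dspow p \<xi> * (r n * h n)"
    using spow_mean_value[OF p] by blast
  then obtain \<xi> where "\<forall>n. \<bar>\<xi> n - a n\<bar> \<le> \<bar>r n * h n\<bar> \<and>
      spow p (a n + r n * h n) - spow p (a n) = dspow p (\<xi> n) * (r n * h n)"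
    unfolding choice_iff by blast
  then have \<xi>: "\<And>n. \<bar>\<xi> n - a n\<bar> \<le> \<bar>r n * h n\<bar>"
    "\<And>n. spow p (a n + r n * h n) - spow p (a n) = dspow p (\<xi> n) * (r n * h n)" by blast+
  have l0: "(\<lambda>n. \<bar>r n * h n\<bar>) \<longlonglongrightarrow> 0"
    using tendsto_rabs[OF tendsto_mult[OF r h]] by simp
  have "(\<lambda>n. \<xi> n - a n) \<longlonglongrightarrow> 0"
    by (rule Lim_null_comparison[OF always_eventually l0]) (simp only: real_norm_def \<xi>(1) simp_thms)
  from tendsto_add[OF this a] have "\<xi> \<longlonglongrightarrow> a0" by simp
  then have "(\<lambda>n. dspow p (\<xi> n) * h n) \<longlonglongrightarrow> dspow p a0 * h0"
    using continuous_on_tendsto_compose[OF dspow_continuous[OF p, of UNIV]] h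
    by (intro tendsto_mult) auto
  moreover have "(spow p (a n + r n * h n) - spow p (a n)) / r n = dspow p (\<xi> n) * h n" for n
    using \<xi>(2)[of n] pos[of n] by simp
  ultimately show ?thesis by simp
qed

lemma spow_difference_quotient_bound:
  assumes p: "p \<ge> 2" and "\<bar>a\<bar> \<le> A" "\<bar>h\<bar> \<le> H" "0 < r" "r \<le> (1::real)"
  shows "\<bar>(spow p (a + r * h) - spow p a) / r\<bar> \<le> dspow p (A + H) * H"
proof -
  obtain \<xi> where \<xi>: "\<bar>\<xi> - a\<bar> \<le> \<bar>r * h\<bar>" "spow p (a + r * h) - spow p a = dspow p \<xi> * (r * h)"
    using spow_mean_value[OF p] by blast
  have "\<bar>r * h\<bar> \<le> 1 * H" unfolding abs_mult using assms by (intro mult_mono) auto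
  then have "\<bar>dspow p \<xi>\<bar> \<le> dspow p (A + H)"
    using \<xi>(1) assms(2) by (intro abs_dspow_le[OF p]) linarith
  then have "\<bar>dspow p \<xi> * h\<bar> \<le> dspow p (A + H) * H"
    unfolding abs_mult using assms(3) by (intro mult_mono) auto
  then show ?thesis using \<xi>(2) assms(4) by simp
qed

section \<open>The p-Laplacian in the frame of the gradient\<close>

text \<open>\<open>(c, d)\<close> is the unit horizontal gradient. In the frame rotated by it the
  linear term depends on one coordinate only, and the operator is \<open>p - 1\<close> times the
  second derivative along the gradient plus the one across it.\<close>

lemma normalized_p_laplacian_frame:
  assumes "horiz_grad U x \<noteq> 0"
  defines "q \<equiv> norm (horiz_grad U x)"
  defines "c \<equiv> horiz 1 U x / q" and "d \<equiv> horiz 2 U x / q"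
  defines "X \<equiv> \<lambda>i j. horiz i (horiz j U) x"
  shows "q > 0" "c\<^sup>2 + d\<^sup>2 = 1"
    "(c * a - d * b) * horiz 1 U x + (d * a + c * b) * horiz 2 U x = q * a"
    "normalized_p_laplacian p U x
      = (p - 1) * (c\<^sup>2 * X 1 1 + c * d * (X 1 2 + X 2 1) + d\<^sup>2 * X 2 2)
        + (d\<^sup>2 * X 1 1 - c * d * (X 1 2 + X 2 1) + c\<^sup>2 * X 2 2)"
proof -
  show q: "q > 0" using assms by simp
  have q2: "q\<^sup>2 = (horiz 1 U x)\<^sup>2 + (horiz 2 U x)\<^sup>2"
    by (simp add: q_def horiz_grad_def norm_vec_def L2_set_def sum_2)
  have "c\<^sup>2 + d\<^sup>2 = ((horiz 1 U x)\<^sup>2 + (horiz 2 U x)\<^sup>2) / q\<^sup>2"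
    by (simp add: c_def d_def power_divide add_divide_distrib)
  then show cd: "c\<^sup>2 + d\<^sup>2 = 1" unfolding q2[symmetric] using q by simp
  have h: "horiz 1 U x = q * c" "horiz 2 U x = q * d" using q by (simp_all add: c_def d_def)
  have "(c * a - d * b) * horiz 1 U x + (d * a + c * b) * horiz 2 U x = q * a * (c\<^sup>2 + d\<^sup>2)"
    unfolding h by (simp add: power2_eq_square algebra_simps)
  then show "(c * a - d * b) * horiz 1 U x + (d * a + c * b) * horiz 2 U x = q * a" using cd by simp
  have n: "(horiz_grad U x /\<^sub>R norm (horiz_grad U x)) $ 1 = c" "(horiz_grad U x /\<^sub>R norm (horiz_grad U x)) $ 2 = d"
    by (simp_all add: c_def d_def q_def horiz_grad_def divide_inverse mult.commute)
  have "normalized_p_laplacian p U x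
      = (p - 2) * (c\<^sup>2 * X 1 1 + c * d * (X 1 2 + X 2 1) + d\<^sup>2 * X 2 2) + (X 1 1 + X 2 2)"
    unfolding normalized_p_laplacian_def Let_def inner_vec_def sum_2 matrix_vector_mult_def 
    by (simp only: vec_lambda_beta sum_2 n inner_real_def) 
      (simp add: sym_horiz_hessian_def horiz_laplacian_def X_def power2_eq_square algebra_simps add_divide_distrib)
  \<comment> \<open>Inserting the factor \<open>c^2 + d^2 = 1\<close> splits the Laplacian into its
    parts along and across the gradient.\<close>
  also have "X 1 1 + X 2 2 = (c\<^sup>2 + d\<^sup>2) * (X 1 1 + X 2 2)" using cd by simp
  finally show "normalized_p_laplacian p U x
      = (p - 1) * (c\<^sup>2 * X 1 1 + c * d * (X 1 2 + X 2 1) + d\<^sup>2 * X 2 2)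
        + (d\<^sup>2 * X 1 1 - c * d * (X 1 2 + X 2 1) + c\<^sup>2 * X 2 2)"
    by (simp add: algebra_simps)
qed

text \<open>Mixed and vertical moments vanish, and the weighted moments of \<open>(z$1)^2\<close>
  and \<open>(z$2)^2\<close> are in the ratio \<open>p - 1\<close> to 1. The form thus integrates to
  a multiple of \<open>(p - 1) * \<alpha> + \<beta> = 0\<close>, and only the \<delta> term
  survives.\<close>

lemma linearized_mean_pos:
  assumes p: "p \<ge> 2" and k: "k \<noteq> 0" and \<delta>: "\<delta> > 0"
    and lap: "(p - 1) * \<alpha> + \<beta> = 0"
  shows "(LINT z|lebesgue_on koranyi_unit_ball. dspow p (k * z$1) *
      (m * (\<alpha> * (z$1)\<^sup>2 + \<gamma> * (z$1 * z$2) + \<beta> * (z$2)\<^sup>2 + \<tau> * z$3) + \<delta> * (z$1)\<^sup>2)) > 0"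
proof -
  let ?M = "lebesgue_on koranyi_unit_ball"
  define I where "I = (LINT z|?M. spow p (z$1) * z$1)"
  have int: "integrable ?M (\<lambda>z. dspow p (z$1) * (z$1)\<^sup>2)" "integrable ?M (\<lambda>z. dspow p (z$1) * (z$1 * z$2))"
    "integrable ?M (\<lambda>z. dspow p (z$1) * (z$2)\<^sup>2)" "integrable ?M (\<lambda>z. dspow p (z$1) * z$3)"
    by (intro integrable_lebesgue_on_compact compact_koranyi_unit_ball continuous_intros p)+
  have I1: "(LINT z|?M. dspow p (z$1) * (z$1)\<^sup>2) = (p - 1) * I"
    by (simp add: dspow_times_square[OF p] I_def)
  have I2: "(LINT z|?M. dspow p (z$1) * (z$2)\<^sup>2) = I"
    using integral_dspow_transverse[OF p] by (simp add: I_def)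
  have "(LINT z|?M. dspow p (k * z$1) *
      (m * (\<alpha> * (z$1)\<^sup>2 + \<gamma> * (z$1 * z$2) + \<beta> * (z$2)\<^sup>2 + \<tau> * z$3) + \<delta> * (z$1)\<^sup>2))
    = (LINT z|?M. \<bar>k\<bar> powr (p - 2) * ((m * \<alpha> + \<delta>) * (dspow p (z$1) * (z$1)\<^sup>2)
        + (m * \<gamma>) * (dspow p (z$1) * (z$1 * z$2)) + (m * \<beta>) * (dspow p (z$1) * (z$2)\<^sup>2)
        + (m * \<tau>) * (dspow p (z$1) * z$3)))"
    by (simp add: dspow_mult[OF k] algebra_simps)
  also have "\<dots> = \<bar>k\<bar> powr (p - 2) * ((m * \<alpha> + \<delta>) * ((p - 1) * I) + m * \<beta> * I)"
    using int by (simp add: I1 I2 integral_dspow_cross[OF p])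
  also have "(m * \<alpha> + \<delta>) * ((p - 1) * I) + m * \<beta> * I = m * I * ((p - 1) * \<alpha> + \<beta>) + \<delta> * (p - 1) * I"
    by (simp add: algebra_simps)
  also have "\<bar>k\<bar> powr (p - 2) * \<dots> > 0"
    using lap \<delta> p k integral_spow_moment_pos[OF p] by (simp add: I_def)
  finally show ?thesis .
qed

section \<open>The strict inequality for the perturbed function\<close>

lemma frame_image_in_neighbourhood:
  assumes "compact C" "open S" "C \<subseteq> S"
  shows "\<exists>r1>0. r1 \<le> 1 \<and> (\<forall>x\<in>C. \<forall>c d z s. \<bar>c\<bar> \<le> 1 \<longrightarrow> \<bar>d\<bar> \<le> 1 \<longrightarrow> 0 \<le> s \<longrightarrow> s \<le> r1 \<longrightarrow>
    z \<in> koranyi_unit_ball \<longrightarrow> x + heis_frame x c d s z \<in> S)"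
proof -
  obtain e where e: "e > 0" "(\<Union>x\<in>C. ball x e) \<subseteq> S"
    using compact_subset_open_imp_ball_epsilon_subset[OF assms] by blast
  obtain B where B: "B > 0" "\<forall>x\<in>C. norm x \<le> B"
    using compact_imp_bounded[OF assms(1)] by (auto simp: bounded_pos)
  \<comment> \<open>Chosen so that the bound of \<open>norm_heis_frame_le\<close> is at most
    \<open>e / 2\<close> for all points of norm at most \<open>B\<close>.\<close>
  define r1 where "r1 = min 1 (e / (2 * (5 + 2 * B)))"
  have r1: "0 < r1" "r1 \<le> 1" "r1 * (5 + 2 * B) < e"
  proof -
    show "0 < r1" "r1 \<le> 1" using e B by (auto simp: r1_def)
    have "r1 * (5 + 2 * B) \<le> e / (2 * (5 + 2 * B)) * (5 + 2 * B)"
      using B by (intro mult_right_mono) (auto simp: r1_def)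
    also have "\<dots> = e / 2" using B by (simp add: field_simps)
    also have "\<dots> < e" using e by simp
    finally show "r1 * (5 + 2 * B) < e" .
  qed
  have "x + heis_frame x c d s z \<in> S"
    if h: "x \<in> C" "\<bar>c\<bar> \<le> 1" "\<bar>d\<bar> \<le> 1" "0 \<le> s" "s \<le> r1" "z \<in> koranyi_unit_ball" for x c d z s
  proof -
    have "norm (heis_frame x c d s z) \<le> s * (5 + 2 * norm x)"
      using h r1 by (intro norm_heis_frame_le) auto
    also have "\<dots> \<le> r1 * (5 + 2 * B)"
      using h B r1 by (intro mult_mono) auto
    also have "\<dots> < e" by (rule r1)
    finally have "x + heis_frame x c d s z \<in> ball x e" by (simp add: dist_norm)
    then show ?thesis using e h(1) by blast
  qed
  then show ?thesis using r1 by blast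
qed

lemma continuous_on_horiz:
  assumes "Ck_on 2 U S"
  shows "continuous_on S (horiz i U)"
proof -
  have "continuous_on S (partial i U)" for i
    using assms by (auto simp: numeral_2_eq_2 differentiable_imp_continuous_on)
  then show ?thesis unfolding horiz_def [abs_def] by (cases "i = 1") (auto intro!: continuous_intros)
qed

text \<open>Any shift that is positive and of order \<open>o(r\<^sup>2)\<close> could replace \<open>r ^ 3\<close>; a positive one is what
  the comparison argument needs.\<close>

lemma strict_p_mean_inequality:
  fixes U :: "real^3 \<Rightarrow> real"
  assumes p: "p \<ge> 2" and C: "compact C" "C \<subseteq> S" and S: "open S" and U: "Ck_on 2 U S"
    and grad: "\<And>x. x \<in> C \<Longrightarrow> horiz_grad U x \<noteq> 0"
    and lap: "\<And>x. x \<in> C \<Longrightarrow> normalized_p_laplacian p U x = 0"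
    and \<delta>: "\<delta> > 0" and nz: "\<And>x. x \<in> C \<Longrightarrow> \<sigma> + 2 * \<delta> * U x \<noteq> 0"
  defines "V \<equiv> \<lambda>y. \<sigma> * U y + \<delta> * (U y)\<^sup>2"
  shows "\<exists>r0>0. \<forall>r x. 0 < r \<longrightarrow> r < r0 \<longrightarrow> x \<in> C \<longrightarrow> closure (heis_ball x r) \<subseteq> S \<and>
    0 < (LINT y|lebesgue_on (closure (heis_ball x r)). spow p (V y - V x - r ^ 3))"
proof (rule ccontr)
  let ?K = "koranyi_unit_ball" and ?M = "lebesgue_on koranyi_unit_ball"
  assume neg: "\<not> ?thesis"
  obtain r1 where r1: "0 < r1" "r1 \<le> 1"
    and in_S: "\<And>x c d z s. x \<in> C \<Longrightarrow> \<bar>c\<bar> \<le> 1 \<Longrightarrow> \<bar>d\<bar> \<le> 1 \<Longrightarrow> 0 \<le> s \<Longrightarrow> s \<le> r1 \<Longrightarrow> z \<in> ?K \<Longrightarrow>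
      x + heis_frame x c d s z \<in> S"
    using frame_image_in_neighbourhood[OF C(1) S C(2)] by blast
  have ball_S: "closure (heis_ball x r) \<subseteq> S" if "x \<in> C" "0 < r" "r \<le> r1" for x r
    using closure_heis_ball[of 1 0 r x] in_S[of x 1 0 r] that by auto
  \<comment> \<open>Below \<open>r1\<close> the inclusion of the ball always holds, so a
    counterexample must violate the integral inequality. Compactness of \<open>C\<close> then makes
    the centres converge along a subsequence while the radii tend to 0.\<close>
  have "\<forall>n. \<exists>r x. 0 < r \<and> r < min r1 (inverse (real (Suc n))) \<and> x \<in> C \<and>
      (LINT y|lebesgue_on (closure (heis_ball x r)). spow p (V y - V x - r ^ 3)) \<le> 0"
  proof
    fix n
    have "0 < min r1 (inverse (real (Suc n)))" using r1 by simp
    then obtain r x where "0 < r" "r < min r1 (inverse (real (Suc n)))" "x \<in> C"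
      "\<not> (closure (heis_ball x r) \<subseteq> S \<and>
        0 < (LINT y|lebesgue_on (closure (heis_ball x r)). spow p (V y - V x - r ^ 3)))"
      using neg by blast
    then show "\<exists>r x. 0 < r \<and> r < min r1 (inverse (real (Suc n))) \<and> x \<in> C \<and>
      (LINT y|lebesgue_on (closure (heis_ball x r)). spow p (V y - V x - r ^ 3)) \<le> 0"
      using ball_S[of x r] by (intro exI[of _ r] exI[of _ x]) auto
  qed
  then obtain R X where RX: "\<forall>n. 0 < R n \<and> R n < min r1 (inverse (real (Suc n))) \<and> X n \<in> C \<and>
      (LINT y|lebesgue_on (closure (heis_ball (X n) (R n))). spow p (V y - V (X n) - R n ^ 3)) \<le> 0"
    unfolding choice_iff by blast
  then have "\<forall>n. X n \<in> C" by blast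
  then obtain x0 \<phi> where x0: "x0 \<in> C" and \<phi>: "strict_mono \<phi>" and lim: "(X \<circ> \<phi>) \<longlonglongrightarrow> x0"
    using C(1) unfolding compact_def by blast
  define r x where "r n = R (\<phi> n)" and "x n = X (\<phi> n)" for n
  have r: "0 < r n" "r n < r1" "r n \<le> 1" and xC: "x n \<in> C" for n
    using RX r1 by (auto simp: r_def x_def min_less_iff_conj dest!: spec[of _ "\<phi> n"])
  have neg_int: "(LINT y|lebesgue_on (closure (heis_ball (x n) (r n))). spow p (V y - V (x n) - r n ^ 3)) \<le> 0" for n
    using RX by (simp add: r_def x_def)
  have xS: "x n \<in> S" "x0 \<in> S" for n using xC x0 C by auto
  have xlim: "x \<longlonglongrightarrow> x0" using lim by (simp add: x_def [abs_def] o_def)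
  have "R \<longlonglongrightarrow> 0"
    by (rule tendsto_sandwich[OF always_eventually always_eventually tendsto_const LIMSEQ_inverse_real_of_nat])
      (use RX in \<open>auto intro: less_imp_le\<close>)
  then have rlim: "r \<longlonglongrightarrow> 0"
    using LIMSEQ_subseq_LIMSEQ[OF _ \<phi>] by (simp add: r_def [abs_def] o_def)
  \<comment> \<open>At each centre the frame is aligned with the gradient, so \<open>U\<close>
    varies to first order only in \<open>z$1\<close>, at rate \<open>Q\<close>.\<close>
  define Q where "Q y = norm (horiz_grad U y)" for y
  define c d where "c y = horiz 1 U y / Q y" and "d y = horiz 2 U y / Q y" for y
  note frame = normalized_p_laplacian_frame[OF grad, folded Q_def, folded c_def d_def]
  have cd1: "\<bar>c y\<bar> \<le> 1" "\<bar>d y\<bar> \<le> 1" if "y \<in> C" for y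
    using frame(2)[OF that] by (simp_all add: abs_square_le_1 [symmetric]) (smt (verit) zero_le_power2)+
  have tends: "(\<lambda>n. f (x n)) \<longlonglongrightarrow> f x0" if "continuous_on S f" for f :: "real^3 \<Rightarrow> real"
    using continuous_on_tendsto_compose[OF that xlim xS(2)] xS(1) by simp
  have contU: "continuous_on S U"
    using U by (simp add: numeral_2_eq_2 differentiable_imp_continuous_on)
  have Qeq: "Q = (\<lambda>y. sqrt ((horiz 1 U y)\<^sup>2 + (horiz 2 U y)\<^sup>2))"
    by (simp add: Q_def fun_eq_iff horiz_grad_def norm_vec_def L2_set_def sum_2)
  have contQ: "continuous_on S Q"
    unfolding Qeq by (intro continuous_intros continuous_on_horiz[OF U])
  have Q0: "Q x0 > 0" using frame(1)[OF x0] .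
  have UQ: "(\<lambda>n. U (x n)) \<longlonglongrightarrow> U x0" "(\<lambda>n. Q (x n)) \<longlonglongrightarrow> Q x0"
    by (intro tends contU contQ)+
  have "(\<lambda>n. horiz i U (x n) / Q (x n)) \<longlonglongrightarrow> horiz i U x0 / Q x0" for i
    using Q0 by (intro tendsto_divide UQ tends continuous_on_horiz[OF U]) simp
  then have lims: "(\<lambda>n. U (x n)) \<longlonglongrightarrow> U x0" "(\<lambda>n. Q (x n)) \<longlonglongrightarrow> Q x0"
    "(\<lambda>n. c (x n)) \<longlonglongrightarrow> c x0" "(\<lambda>n. d (x n)) \<longlonglongrightarrow> d x0"
    using UQ by (simp_all add: c_def d_def)
  define y where "y n z = x n + heis_frame (x n) (c (x n)) (d (x n)) (r n) z" for n z
  \<comment> \<open>The rescaled second-order remainder of \<open>U\<close>; by Taylor's formula it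
    is a value of \<open>frame_second_deriv\<close> at an intermediate parameter below
    \<open>r n\<close>.\<close>
  define g where "g n z = 2 * (U (y n z) - U (x n) - r n * (Q (x n) * z$1)) / (r n)\<^sup>2" for n z
  let ?G = "\<lambda>(x, c, d, z, s). frame_second_deriv U x c d z s"
  let ?T = "C \<times> {-1..1::real} \<times> {-1..1::real} \<times> ?K \<times> {0..r1}"
  have "?T \<subseteq> {(x, c, d, z, s). x + heis_frame x c d s z \<in> S}"
  proof
    fix w assume w: "w \<in> ?T"
    obtain x c d z s where w_eq: "w = (x, c, d, z, s)" by (cases w rule: prod_cases5)
    show "w \<in> {(x, c, d, z, s). x + heis_frame x c d s z \<in> S}"
      using w in_S[of x c d s z] by (simp add: w_eq abs_le_iff minus_le_iff)
  qed
  then have contG: "continuous_on ?T ?G"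
    using continuous_on_frame_second_deriv[OF U] continuous_on_subset by blast
  have "compact ?T" by (intro compact_Times C compact_koranyi_unit_ball compact_Icc)
  then have "bounded (?G ` ?T)"
    using compact_imp_bounded compact_continuous_image contG by blast
  then obtain H where H: "\<And>w. w \<in> ?T \<Longrightarrow> \<bar>?G w\<bar> \<le> H"
    unfolding bounded_iff by (metis imageI real_norm_def)
  have memT: "(y, c y, d y, z, s) \<in> ?T" if "y \<in> C" "z \<in> ?K" "0 \<le> s" "s \<le> r1" for y z s
    using that cd1[OF that(1)] by (auto simp: abs_le_iff minus_le_iff)
  have g: "\<exists>s. 0 < s \<and> s < r n \<and> g n z = ?G (x n, c (x n), d (x n), z, s)" if z: "z \<in> ?K" for n z
  proof -
    have "x n + heis_frame (x n) (c (x n)) (d (x n)) s z \<in> S" if "0 \<le> s" "s \<le> r n" for s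
      using in_S[OF xC cd1[OF xC] that(1) _ z] that(2) r(2)[of n] by simp
    then have "\<exists>s. 0 < s \<and> s < r n \<and> U (y n z) = U (x n) + r n * (Q (x n) * z$1)
        + (r n)\<^sup>2 / 2 * frame_second_deriv U (x n) (c (x n)) (d (x n)) z s"
      using frame_second_order_Taylor[OF S U r(1)[of n], of "x n" "c (x n)" "d (x n)" z]
      by (simp only: y_def frame(3)[OF xC])
    then obtain s where s: "0 < s" "s < r n" "U (y n z) = U (x n) + r n * (Q (x n) * z$1)
        + (r n)\<^sup>2 / 2 * frame_second_deriv U (x n) (c (x n)) (d (x n)) z s"
      by (elim exE conjE)
    then have "g n z = frame_second_deriv U (x n) (c (x n)) (d (x n)) z s"
      using r(1)[of n] by (simp add: g_def)
    then show ?thesis using s(1,2) by auto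
  qed
  have gH: "\<bar>g n z\<bar> \<le> H" if "z \<in> ?K" for n z
  proof -
    obtain s where s: "0 < s" "s < r n" "g n z = ?G (x n, c (x n), d (x n), z, s)"
      using g[OF \<open>z \<in> ?K\<close>] by blast
    show ?thesis unfolding s(3) using s r(2)[of n] that by (intro H memT xC) auto
  qed
  have glim: "(\<lambda>n. g n z) \<longlonglongrightarrow> ?G (x0, c x0, d x0, z, 0)" if z: "z \<in> ?K" for z
  proof -
    obtain s where s: "\<forall>n. 0 < s n \<and> s n < r n \<and> g n z = ?G (x n, c (x n), d (x n), z, s n)"
      using g[OF z] choice[of "\<lambda>n s. 0 < s \<and> s < r n \<and> g n z = ?G (x n, c (x n), d (x n), z, s)"] by blast
    have "s \<longlonglongrightarrow> 0"
      by (rule tendsto_sandwich[OF always_eventually always_eventually tendsto_const rlim])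
        (use s in \<open>auto intro: less_imp_le\<close>)
    then have "(\<lambda>n. (x n, c (x n), d (x n), z, s n)) \<longlonglongrightarrow> (x0, c x0, d x0, z, 0)"
      by (intro tendsto_Pair lims xlim tendsto_const)
    moreover have "(x0, c x0, d x0, z, 0) \<in> ?T" using r1 by (intro memT x0 z) auto
    moreover have "(x n, c (x n), d (x n), z, s n) \<in> ?T" for n
    proof -
      have "0 < s n" "s n < r n" using s by blast+
      then show ?thesis using r(2)[of n] by (intro memT xC z) auto
    qed
    ultimately have "(\<lambda>n. ?G (x n, c (x n), d (x n), z, s n)) \<longlonglongrightarrow> ?G (x0, c x0, d x0, z, 0)"
      by (intro continuous_on_tendsto_compose[OF contG] always_eventually) blast+
    then show ?thesis using s by simp
  qed
  \<comment> \<open>\<open>m n\<close> is the derivative of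
    \<open>\<sigma> * t + \<delta> * t^2\<close> at \<open>t = U (x n)\<close>; \<open>k n\<close>
    is the resulting slope of \<open>V\<close>, and \<open>h n\<close> collects the second-order
    terms. The shift \<open>r n ^ 3\<close> leaves only \<open>- r n\<close> in \<open>h n\<close>,
    which vanishes in the limit.\<close>
  define m where "m n = \<sigma> + 2 * \<delta> * U (x n)" for n
  define k where "k n = m n * Q (x n)" for n
  define h where "h n z = m n / 2 * g n z + \<delta> * (Q (x n) * z$1 + r n / 2 * g n z)\<^sup>2 - r n" for n z
  define m0 where "m0 = \<sigma> + 2 * \<delta> * U x0"
  \<comment> \<open>The trivial terms with 0 mirror the shape of \<open>h\<close>, so that the limit
    can be taken summand by summand.\<close>
  define h0 where "h0 z = m0 / 2 * ?G (x0, c x0, d x0, z, 0) + \<delta> * (Q x0 * z$1 + 0 / 2 * ?G (x0, c x0, d x0, z, 0))\<^sup>2 - 0" for z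
  have mlim: "m \<longlonglongrightarrow> m0" unfolding m_def m0_def by (intro tendsto_intros lims)
  have klim: "k \<longlonglongrightarrow> m0 * Q x0" unfolding k_def by (intro tendsto_intros lims mlim)
  have hlim: "(\<lambda>n. h n z) \<longlonglongrightarrow> h0 z" if "z \<in> ?K" for z
    unfolding h_def h0_def by (intro tendsto_intros lims mlim glim that rlim) auto
  \<comment> \<open>An exact identity rather than an expansion, because \<open>V\<close> is a
    quadratic polynomial in \<open>U\<close> and \<open>g\<close> is the exact remainder.\<close>
  have expand: "V (y n z) - V (x n) - r n ^ 3 = r n * (k n * z$1 + r n * h n z)" for n z
  proof -
    define D where "D = Q (x n) * z$1 + r n / 2 * g n z"
    have D: "U (y n z) = U (x n) + r n * D"
      using r(1)[of n] by (simp add: D_def g_def power2_eq_square field_simps)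
    have kh: "k n * z$1 + r n * h n z = m n * D + r n * (\<delta> * D\<^sup>2 - r n)"
      unfolding k_def h_def D_def[symmetric] by (simp add: D_def algebra_simps)
    show ?thesis
      unfolding kh V_def D m_def by (simp add: power2_eq_square power3_eq_cube algebra_simps)
  qed
  have scaled: "spow p (V (y n z) - V (x n) - r n ^ 3) = r n powr (p - 1) * spow p (k n * z$1 + r n * h n z)" for n z
    unfolding expand by (rule spow_mult_pos[OF r(1)])
  \<comment> \<open>Passing to the unit ball costs only the positive factors \<open>r n ^ 4\<close>
    and \<open>r n powr (p - 1)\<close>, so the sign is kept.\<close>
  have change: "integrable ?M (\<lambda>z. spow p (k n * z$1 + r n * h n z))"
    "(LINT z|?M. spow p (k n * z$1 + r n * h n z)) \<le> 0" for n
  proof -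
    let ?L = "heis_frame (x n) (c (x n)) (d (x n)) (r n)"
    let ?f = "\<lambda>y. spow p (V y - V (x n) - r n ^ 3)"
    have im: "(\<lambda>z. x n + ?L z) ` ?K = closure (heis_ball (x n) (r n))"
      using closure_heis_ball[OF frame(2)[OF xC] r(1)] by simp
    have det: "det (matrix ?L) = r n ^ 4" using frame(2)[OF xC] by (simp add: det_heis_frame)
    have "continuous_on S V" unfolding V_def by (intro continuous_intros contU)
    then have "continuous_on ((\<lambda>z. x n + ?L z) ` ?K) V"
      unfolding im using ball_S[OF xC r(1)] r(2) continuous_on_subset by (meson less_imp_le)
    then have cont: "continuous_on ((\<lambda>z. x n + ?L z) ` ?K) ?f"
      by (intro continuous_intros p)
    have det0: "det (matrix ?L) \<noteq> 0" using det r(1)[of n] by simp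
    note cv = integral_affine_image_compact[OF linear_heis_frame det0 compact_koranyi_unit_ball cont]
    have pos: "r n powr (p - 1) > 0" "r n ^ 4 > 0" using r(1)[of n] by auto
    show "integrable ?M (\<lambda>z. spow p (k n * z$1 + r n * h n z))"
      using cv(1) pos unfolding y_def[symmetric] scaled by simp
    have "r n ^ 4 * (r n powr (p - 1) * (LINT z|?M. spow p (k n * z$1 + r n * h n z))) \<le> 0"
      using cv(2) neg_int[of n] pos unfolding y_def[symmetric] im[folded y_def] det scaled by simp
    then show "(LINT z|?M. spow p (k n * z$1 + r n * h n z)) \<le> 0"
      using pos by (simp add: mult_le_0_iff)
  qed
  have int_a: "integrable ?M (\<lambda>z. spow p (k n * z$1))" for n
    by (intro integrable_lebesgue_on_compact compact_koranyi_unit_ball continuous_intros p)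
  \<comment> \<open>Subtracting \<open>spow p (k n * z$1)\<close> does not change the integral,
    since that term is odd in \<open>z$1\<close>; dividing by \<open>r n\<close> then retains the
    sign and produces a difference quotient.\<close>
  let ?q = "\<lambda>n z. (spow p (k n * z$1 + r n * h n z) - spow p (k n * z$1)) / r n"
  have q_int: "(LINT z|?M. ?q n z) \<le> 0" for n
    using change[of n] int_a[of n] r(1)[of n] integral_spow_odd[OF p, of "k n"]
    by (simp add: divide_le_0_iff)
  obtain A where A: "\<And>n. \<bar>k n\<bar> \<le> A"
    using convergent_imp_Bseq[OF convergentI[OF klim]] unfolding Bseq_def by auto
  obtain B where B: "\<And>n. \<bar>m n\<bar> \<le> B"
    using convergent_imp_Bseq[OF convergentI[OF mlim]] unfolding Bseq_def by auto
  obtain E where E: "\<And>n. \<bar>Q (x n)\<bar> \<le> E"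
    using convergent_imp_Bseq[OF convergentI[OF lims(2)]] unfolding Bseq_def by auto
  \<comment> \<open>\<open>B\<close>, \<open>E\<close> and \<open>H\<close> bound \<open>m\<close>,
    \<open>Q\<close> and \<open>g\<close>; the final 1 absorbs \<open>r n\<close>.\<close>
  define W where "W = B / 2 * H + \<delta> * (E + 1 / 2 * H)\<^sup>2 + 1"
  have hW: "\<bar>h n z\<bar> \<le> W" if z: "z \<in> ?K" for n z
  proof -
    have "\<bar>m n / 2 * g n z\<bar> \<le> B / 2 * H"
      unfolding abs_mult using B[of n] gH[OF z, of n] by (intro mult_mono) auto
    moreover have "\<bar>Q (x n) * z$1\<bar> \<le> E * 1"
      unfolding abs_mult using E[of n] koranyi_unit_ball_component_le[OF z] by (intro mult_mono) auto
    moreover have "\<bar>r n / 2 * g n z\<bar> \<le> 1 / 2 * H"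
      unfolding abs_mult using r[of n] gH[OF z, of n] by (intro mult_mono) auto
    ultimately have a: "\<bar>m n / 2 * g n z\<bar> \<le> B / 2 * H" "\<bar>Q (x n) * z$1 + r n / 2 * g n z\<bar> \<le> E + 1 / 2 * H"
      by linarith+
    have "\<delta> * (Q (x n) * z$1 + r n / 2 * g n z)\<^sup>2 \<le> \<delta> * (E + 1 / 2 * H)\<^sup>2"
      using a(2) \<delta> by (intro mult_left_mono abs_le_square_iff[THEN iffD1]) auto
    moreover have "0 \<le> \<delta> * (Q (x n) * z$1 + r n / 2 * g n z)\<^sup>2" using \<delta> by simp
    ultimately show ?thesis
      unfolding h_def W_def using a(1) r[of n] by linarith
  qed
  have "(\<lambda>n. LINT z|?M. ?q n z) \<longlonglongrightarrow> (LINT z|?M. dspow p (m0 * Q x0 * z$1) * h0 z)"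
  proof (rule integral_dominated_convergence[where w = "\<lambda>_. dspow p (A + W) * W"])
    interpret finite_measure ?M
      by (intro finite_measure_lebesgue_on lmeasurable_compact compact_koranyi_unit_ball)
    show "integrable ?M (\<lambda>_. dspow p (A + W) * W)" by simp
    show meas: "(\<lambda>z. ?q n z) \<in> borel_measurable ?M" for n
      using change(1)[of n] int_a[of n] by (auto intro!: borel_measurable_divide borel_measurable_diff)
    have lim: "(\<lambda>n. ?q n z) \<longlonglongrightarrow> dspow p (m0 * Q x0 * z$1) * h0 z" if "z \<in> ?K" for z
      using that by (intro spow_difference_quotient_tendsto[OF p] tendsto_intros klim hlim rlim r)
    then show "AE z in ?M. (\<lambda>n. ?q n z) \<longlonglongrightarrow> dspow p (m0 * Q x0 * z$1) * h0 z"
      by (auto intro!: AE_I2)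
    show "(\<lambda>z. dspow p (m0 * Q x0 * z$1) * h0 z) \<in> borel_measurable ?M"
      by (rule borel_measurable_LIMSEQ_real[OF lim meas]) simp
    fix n
    have "\<bar>?q n z\<bar> \<le> dspow p (A + W) * W" if z: "z \<in> ?K" for z
    proof (rule spow_difference_quotient_bound[OF p])
      have "\<bar>k n * z$1\<bar> \<le> A * 1"
        unfolding abs_mult using A[of n] koranyi_unit_ball_component_le[OF z] by (intro mult_mono) auto
      then show "\<bar>k n * z$1\<bar> \<le> A" by simp
    qed (use hW[OF z] r in auto)
    then show "AE z in ?M. norm (?q n z) \<le> dspow p (A + W) * W"
      by (auto intro!: AE_I2)
  qed
  then have "(LINT z|?M. dspow p (m0 * Q x0 * z$1) * h0 z) \<le> 0"
    by (rule LIMSEQ_le_const2) (use q_int in auto)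
  moreover have "(LINT z|?M. dspow p (m0 * Q x0 * z$1) * h0 z) > 0"
  proof -
    \<comment> \<open>Coefficients of the limiting quadratic form in the rotated coordinates: along
      the gradient, across it, and mixed. The equation for \<open>U\<close> says exactly that
      \<open>(p - 1) * \<alpha> + \<beta> = 0\<close>.\<close>
    define \<alpha> \<beta> \<gamma> where "\<alpha> = (c x0)\<^sup>2 * horiz 1 (horiz 1 U) x0 
        + c x0 * d x0 * (horiz 1 (horiz 2 U) x0 + horiz 2 (horiz 1 U) x0) + (d x0)\<^sup>2 * horiz 2 (horiz 2 U) x0"
      and "\<beta> = (d x0)\<^sup>2 * horiz 1 (horiz 1 U) x0 
        - c x0 * d x0 * (horiz 1 (horiz 2 U) x0 + horiz 2 (horiz 1 U) x0) + (c x0)\<^sup>2 * horiz 2 (horiz 2 U) x0"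
      and "\<gamma> = 2 * c x0 * d x0 * (horiz 2 (horiz 2 U) x0 - horiz 1 (horiz 1 U) x0)
        + ((c x0)\<^sup>2 - (d x0)\<^sup>2) * (horiz 1 (horiz 2 U) x0 + horiz 2 (horiz 1 U) x0)"
    have "(p - 1) * \<alpha> + \<beta> = 0"
      using frame(4)[OF x0, of p] lap[OF x0] by (simp add: \<alpha>_def \<beta>_def)
    moreover have "m0 * Q x0 \<noteq> 0" using nz[OF x0] Q0 by (simp add: m0_def)
    moreover have "\<delta> * (Q x0)\<^sup>2 > 0" using \<delta> Q0 by simp
    ultimately have "(LINT z|?M. dspow p (m0 * Q x0 * z$1) *
      (m0 / 2 * (\<alpha> * (z$1)\<^sup>2 + \<gamma> * (z$1 * z$2) + \<beta> * (z$2)\<^sup>2 + 2 * partial 3 U x0 * z$3) + \<delta> * (Q x0)\<^sup>2 * (z$1)\<^sup>2)) > 0"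
      by (intro linearized_mean_pos[OF p])
    moreover have "h0 z = m0 / 2 * (\<alpha> * (z$1)\<^sup>2 + \<gamma> * (z$1 * z$2) + \<beta> * (z$2)\<^sup>2 + 2 * partial 3 U x0 * z$3)
        + \<delta> * (Q x0)\<^sup>2 * (z$1)\<^sup>2" for z
    proof -
      have "partial j U differentiable (at x0)" for j
        using U xS(2) S by (auto simp: numeral_2_eq_2 differentiable_on_eq_differentiable_at)
      note * = frame_second_deriv_0[OF this, of "c x0" "d x0" z]
      have "frame_second_deriv U x0 (c x0) (d x0) z 0
        = \<alpha> * (z$1)\<^sup>2 + \<gamma> * (z$1 * z$2) + \<beta> * (z$2)\<^sup>2 + 2 * partial 3 U x0 * z$3"
        unfolding * \<alpha>_def \<beta>_def \<gamma>_def by (simp add: power2_eq_square algebra_simps)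
      then show ?thesis by (simp add: h0_def power_mult_distrib)
    qed
    ultimately show ?thesis by simp
  qed
  ultimately show False by simp
qed

section \<open>Comparison\<close>

lemma heis_infdist_le: "z \<in> A \<Longrightarrow> heis_infdist x A \<le> heis_dist x z"
  unfolding heis_infdist_def heis_dist_def
  by (rule cINF_lower) (auto intro!: bdd_belowI2[of _ 0] koranyi_gauge_nonneg)

lemma closure_heis_ball_subset_extended_domain:
  assumes "x \<in> \<Omega>" "\<epsilon> > 0"
  shows "closure (heis_ball x \<epsilon>) \<subseteq> extended_domain \<Omega> \<epsilon>"
proof
  fix y assume "y \<in> closure (heis_ball x \<epsilon>)"
  then have "heis_dist y x \<le> \<epsilon>"
    using heis_dist_le_if_closure_heis_ball[of y x \<epsilon>] assms(2) by (simp add: heis_dist_commute)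
  then show "y \<in> extended_domain \<Omega> \<epsilon>"
    using heis_infdist_le[OF assms(1), of y] by (auto simp: extended_domain_def boundary_strip_def)
qed

lemma closure_subset_extended_domain:
  assumes "\<epsilon> > 0"
  shows "closure \<Omega> \<subseteq> extended_domain \<Omega> \<epsilon>"
proof
  fix x assume "x \<in> closure \<Omega>"
  then obtain z where "z \<in> \<Omega>" "z \<in> heis_ball x \<epsilon>"
    using open_Int_closure_eq_empty[OF open_heis_ball[OF assms, of x], of \<Omega>]
      centre_in_heis_ball[OF assms, of x] by blast
  then show "x \<in> extended_domain \<Omega> \<epsilon>"
    using heis_infdist_le[of z \<Omega> x] by (auto simp: extended_domain_def boundary_strip_def heis_ball_def)
qed

text \<open>The radius is strictly larger than \<epsilon> because the infimum defining the distance
  need not be attained in \<Omega>.\<close>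

lemma extended_domain_subset_balls:
  assumes "\<Omega> \<noteq> {}" "0 < \<epsilon>" "\<epsilon> < r"
  shows "extended_domain \<Omega> \<epsilon> \<subseteq> (\<Union>x\<in>\<Omega>. closure (heis_ball x r))"
proof
  fix y assume y: "y \<in> extended_domain \<Omega> \<epsilon>"
  have "\<exists>x\<in>\<Omega>. y \<in> heis_ball x r"
  proof (cases "y \<in> \<Omega>")
    case True
    then show ?thesis using centre_in_heis_ball[of r y] assms by auto
  next
    case False
    then have "heis_infdist y \<Omega> < r"
      using y assms by (auto simp: extended_domain_def boundary_strip_def)
    then have "\<not> (\<forall>x\<in>\<Omega>. r \<le> heis_dist y x)"
      using cINF_greatest[OF assms(1), of r "heis_dist y"] by (auto simp: heis_infdist_def)
    then show ?thesis by (auto simp: heis_ball_def heis_dist_commute not_le)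
  qed
  then show "y \<in> (\<Union>x\<in>\<Omega>. closure (heis_ball x r))"
    using closure_subset by blast
qed

text \<open>All extended domains with \<epsilon> below \<open>r\<close> lie in one compact subset of
  \<open>S\<close>, the union of the closed \<open>r\<close>-balls centred in
  \<open>closure \<Omega>\<close>, here a continuous image of a product.\<close>

lemma bounded_on_extended_domains:
  assumes "open S" "closure \<Omega> \<subseteq> S" "bounded \<Omega>" "\<Omega> \<noteq> {}" "continuous_on S (U :: real^3 \<Rightarrow> real)"
  shows "\<exists>r>0. \<exists>B>0. \<forall>\<epsilon> y. 0 < \<epsilon> \<longrightarrow> \<epsilon> < r \<longrightarrow> y \<in> extended_domain \<Omega> \<epsilon> \<longrightarrow> \<bar>U y\<bar> \<le> B"
proof -
  let ?K = koranyi_unit_ball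
  have C: "compact (closure \<Omega>)" using assms(3) by simp
  obtain r where r: "0 < r" "r \<le> 1"
    and in_S: "\<And>x c d z s. x \<in> closure \<Omega> \<Longrightarrow> \<bar>c\<bar> \<le> 1 \<Longrightarrow> \<bar>d\<bar> \<le> 1 \<Longrightarrow> 0 \<le> s \<Longrightarrow> s \<le> r \<Longrightarrow> z \<in> ?K \<Longrightarrow>
      x + heis_frame x c d s z \<in> S"
    using frame_image_in_neighbourhood[OF C assms(1,2)] by blast
  let ?f = "\<lambda>(x, c, d, z, s). x + heis_frame x c d s z"
  let ?T = "closure \<Omega> \<times> {1} \<times> {0} \<times> ?K \<times> {r}"
  have T: "compact (?f ` ?T)"
    by (intro compact_continuous_image continuous_on_heis_frame compact_Times C
        compact_koranyi_unit_ball) auto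
  have "?f ` ?T \<subseteq> S"
    using in_S r by auto
  then have "bounded (U ` ?f ` ?T)"
    using T assms(5) by (meson compact_continuous_image compact_imp_bounded continuous_on_subset)
  then obtain B where B: "B > 0" "\<forall>v\<in>U ` ?f ` ?T. norm v \<le> B"
    using bounded_pos by blast
  have UB: "\<bar>U w\<bar> \<le> B" if "w \<in> ?f ` ?T" for w
    using bspec[OF B(2) imageI[OF that]] by simp
  have "y \<in> ?f ` ?T" if e: "0 < \<epsilon>" "\<epsilon> < r" and y: "y \<in> extended_domain \<Omega> \<epsilon>" for \<epsilon> y
  proof -
    obtain x where x: "x \<in> \<Omega>" "y \<in> closure (heis_ball x r)"
      using extended_domain_subset_balls[OF assms(4) e] y by blast
    then obtain z where z: "z \<in> ?K" "y = x + heis_frame x 1 0 r z"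
      using closure_heis_ball[of 1 0 r x] r by auto
    have "(x, 1, 0, z, r) \<in> ?T" using x(1) z(1) closure_subset by auto
    then have "?f (x, 1, 0, z, r) \<in> ?f ` ?T" by (rule imageI)
    then show ?thesis by (simp add: z(2))
  qed
  then show ?thesis using r(1) B(1) UB by meson
qed

section \<open>The comparison principle\<close>

text \<open>The supremum \<open>M\<close> of \<open>V - u\<close> need not be attained. At a point
  of \<Omega> where \<open>V - u\<close> is at least \<open>M - t\<close>, one gets
  \<open>V y - V x - t \<le> u y - u x\<close> on the ball, so a positive integral would be at most
  zero. Hence \<open>M \<le> max b (M - t)\<close>, and \<open>t > 0\<close> forces
  \<open>M \<le> b\<close>.\<close>

lemma p_mean_comparison:
  fixes u V :: "real^3 \<Rightarrow> real"
  assumes p: "p \<ge> 2" and \<epsilon>: "\<epsilon> > 0"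
    and u: "u \<in> bounded_measurable_on (extended_domain \<Omega> \<epsilon>)"
    and V: "bounded (V ` extended_domain \<Omega> \<epsilon>)" "\<And>x. x \<in> \<Omega> \<Longrightarrow> continuous_on (closure (heis_ball x \<epsilon>)) V"
    and mean: "\<And>x. x \<in> \<Omega> \<Longrightarrow> (LINT y|lebesgue_on (closure (heis_ball x \<epsilon>)). spow p (u y - u x)) = 0"
    and strict: "\<And>x. x \<in> \<Omega> \<Longrightarrow> 0 < (LINT y|lebesgue_on (closure (heis_ball x \<epsilon>)). spow p (V y - V x - t))"
    and t: "t > 0"
    and strip: "\<And>x. x \<in> boundary_strip \<Omega> \<epsilon> \<Longrightarrow> V x - u x \<le> b"
    and x: "x \<in> extended_domain \<Omega> \<epsilon>"
  shows "V x - u x \<le> b"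
proof -
  let ?E = "extended_domain \<Omega> \<epsilon>"
  define M where "M = (SUP x\<in>?E. V x - u x)"
  obtain Bu where Bu: "\<And>x. x \<in> ?E \<Longrightarrow> \<bar>u x\<bar> \<le> Bu"
    using u by (auto simp: bounded_measurable_on_def bounded_iff)
  obtain BV where BV: "\<And>x. x \<in> ?E \<Longrightarrow> \<bar>V x\<bar> \<le> BV"
    using V(1) by (auto simp: bounded_iff)
  have "bdd_above ((\<lambda>x. V x - u x) ` ?E)"
  proof (rule bdd_aboveI2)
    show "V x - u x \<le> BV + Bu" if "x \<in> ?E" for x
      using Bu[OF that] BV[OF that] by linarith
  qed
  then have M: "V y - u y \<le> M" if "y \<in> ?E" for y
    unfolding M_def using that by (rule cSUP_upper2) simp
  have int: "V x - u x < M - t" if x: "x \<in> \<Omega>" for x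
  proof (rule ccontr)
    assume neg: "\<not> V x - u x < M - t"
    let ?A = "closure (heis_ball x \<epsilon>)"
    have A: "?A \<subseteq> ?E" by (rule closure_heis_ball_subset_extended_domain[OF x \<epsilon>])
    have cA: "compact ?A" by (rule compact_closure_heis_ball[OF \<epsilon>])
    interpret finite_measure "lebesgue_on ?A"
      by (intro finite_measure_lebesgue_on lmeasurable_compact cA)
    have "u \<in> borel_measurable (lebesgue_on ?A)"
      using u A measurable_restrict_mono by (auto simp: bounded_measurable_on_def)
    then have iu: "integrable (lebesgue_on ?A) (\<lambda>y. spow p (u y - u x))"
    proof (intro integrable_spow[OF p, of _ "Bu + \<bar>u x\<bar>"] borel_measurable_diff)
      show "\<bar>u y - u x\<bar> \<le> Bu + \<bar>u x\<bar>" if "y \<in> space (lebesgue_on ?A)" for y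
        using Bu[of y] that A by auto
    qed auto
    have iV: "integrable (lebesgue_on ?A) (\<lambda>y. spow p (V y - V x - t))"
      by (intro integrable_lebesgue_on_compact cA continuous_intros p V x)
    have "(LINT y|lebesgue_on ?A. spow p (V y - V x - t)) \<le> (LINT y|lebesgue_on ?A. spow p (u y - u x))"
    proof (rule integral_mono[OF iV iu])
      fix y assume "y \<in> space (lebesgue_on ?A)"
      then have "V y - u y \<le> M" using A by (intro M) auto
      then show "spow p (V y - V x - t) \<le> spow p (u y - u x)"
        using neg by (intro spow_mono[OF p]) linarith
    qed
    then show False using mean[OF x] strict[OF x] by simp
  qed
  have "V y - u y \<le> max b (M - t)" if "y \<in> ?E" for y
    using that int[of y] strip[of y] by (auto simp: extended_domain_def)
  moreover have "?E \<noteq> {}" using x by blast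
  ultimately have "M \<le> max b (M - t)"
    unfolding M_def by (intro cSUP_least)
  then have "M \<le> b" using t by linarith
  then show ?thesis using M[OF x] by linarith
qed

lemma p_mean_solution_integral:
  assumes p: "p \<ge> 2" and u: "p_mean_solution p \<Omega> U \<epsilon> u" and \<epsilon>: "\<epsilon> > 0" and x: "x \<in> \<Omega>"
  shows "(LINT y|lebesgue_on (closure (heis_ball x \<epsilon>)). spow p (u y - u x)) = 0"
proof -
  let ?A = "closure (heis_ball x \<epsilon>)"
  have A: "?A \<subseteq> extended_domain \<Omega> \<epsilon>" by (rule closure_heis_ball_subset_extended_domain[OF x \<epsilon>])
  have "u \<in> bounded_measurable_on (extended_domain \<Omega> \<epsilon>)" using u by (simp add: p_mean_solution_def)
  then have "u \<in> borel_measurable (lebesgue_on ?A)" "bounded (u ` ?A)"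
    using A measurable_restrict_mono bounded_subset[OF _ image_mono[OF A]]
    by (auto simp: bounded_measurable_on_def)
  then have "(LINT y|lebesgue_on ?A. spow p (u y - natural_p_mean p u \<epsilon> x)) = 0"
    by (intro natural_p_mean_root p lmeasurable_compact compact_closure_heis_ball measure_closure_heis_ball \<epsilon>)
  moreover have "u x = natural_p_mean p u \<epsilon> x" using u x by (simp add: p_mean_solution_def)
  ultimately show ?thesis by simp
qed

lemma p_mean_solution_one_sided:
  fixes \<sigma> :: real
  assumes p: "p \<ge> 2" and \<epsilon>: "\<epsilon> > 0" and u: "p_mean_solution p \<Omega> U \<epsilon> u"
    and \<sigma>: "\<bar>\<sigma>\<bar> = 1" and \<delta>: "\<delta> > 0"
    and S: "continuous_on S U" "\<And>x. x \<in> \<Omega> \<Longrightarrow> closure (heis_ball x \<epsilon>) \<subseteq> S"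
    and B: "\<And>y. y \<in> extended_domain \<Omega> \<epsilon> \<Longrightarrow> \<bar>U y\<bar> \<le> B"
    and strict: "\<And>x. x \<in> \<Omega> \<Longrightarrow> 0 < (LINT y|lebesgue_on (closure (heis_ball x \<epsilon>)).
      spow p (\<sigma> * U y + \<delta> * (U y)\<^sup>2 - (\<sigma> * U x + \<delta> * (U x)\<^sup>2) - \<epsilon> ^ 3))"
    and x: "x \<in> extended_domain \<Omega> \<epsilon>"
  shows "\<sigma> * (U x - u x) \<le> \<delta> * B\<^sup>2"
proof -
  let ?E = "extended_domain \<Omega> \<epsilon>"
  have sq: "(U y)\<^sup>2 \<le> B\<^sup>2" if "y \<in> ?E" for y
    using B[OF that] by (intro abs_le_square_iff[THEN iffD1]) auto
  have "(\<lambda>y. \<sigma> * U y + \<delta> * (U y)\<^sup>2) x - (\<lambda>y. \<sigma> * u y) x \<le> \<delta> * B\<^sup>2"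
  proof (rule p_mean_comparison[OF p \<epsilon>])
    have u': "bounded (u ` ?E)" "u \<in> borel_measurable (lebesgue_on ?E)"
      using u by (auto simp: p_mean_solution_def bounded_measurable_on_def)
    have "bounded ((\<lambda>y. \<sigma> * u y) ` ?E)"
      using u'(1) \<sigma> by (simp add: bounded_iff abs_mult)
    then show "(\<lambda>y. \<sigma> * u y) \<in> bounded_measurable_on ?E"
      using u'(2) by (auto simp: bounded_measurable_on_def)
    show "bounded ((\<lambda>y. \<sigma> * U y + \<delta> * (U y)\<^sup>2) ` ?E)"
      unfolding bounded_iff
    proof (intro exI ballI, elim imageE, simp only: real_norm_def)
      fix y assume y: "y \<in> ?E"
      have "\<bar>\<sigma> * U y\<bar> \<le> B" using B[OF y] \<sigma> by (simp add: abs_mult)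
      moreover have "\<delta> * (U y)\<^sup>2 \<le> \<delta> * B\<^sup>2" "0 \<le> \<delta> * (U y)\<^sup>2" using sq[OF y] \<delta> by auto
      ultimately show "\<bar>\<sigma> * U y + \<delta> * (U y)\<^sup>2\<bar> \<le> B + \<delta> * B\<^sup>2" by linarith
    qed
    show "continuous_on (closure (heis_ball x \<epsilon>)) (\<lambda>y. \<sigma> * U y + \<delta> * (U y)\<^sup>2)" if "x \<in> \<Omega>" for x
      using continuous_on_subset[OF S(1) S(2)[OF that]] by (intro continuous_intros)
    show "(LINT y|lebesgue_on (closure (heis_ball x \<epsilon>)). spow p (\<sigma> * u y - \<sigma> * u x)) = 0" if "x \<in> \<Omega>" for x
      using p_mean_solution_integral[OF p u \<epsilon> that] by (simp add: spow_mult flip: right_diff_distrib)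
    show "(\<sigma> * U y + \<delta> * (U y)\<^sup>2) - \<sigma> * u y \<le> \<delta> * B\<^sup>2" if "y \<in> boundary_strip \<Omega> \<epsilon>" for y
      using that u sq[of y] \<delta> by (simp add: p_mean_solution_def extended_domain_def)
    show "0 < \<epsilon> ^ 3" using \<epsilon> by simp
  qed (use strict x in auto)
  moreover have "0 \<le> \<delta> * (U x)\<^sup>2" using \<delta> by simp
  ultimately show ?thesis by (simp add: right_diff_distrib)
qed

section \<open>Uniform convergence\<close>

theorem proposition1p9:
  fixes p :: real and \<Omega> \<Omega>' :: "(real^3) set" and U :: "real^3 \<Rightarrow> real"
    and \<epsilon>0 :: real and u :: "real \<Rightarrow> real^3 \<Rightarrow> real"
  assumes "2 \<le> p"
    and "open \<Omega>" "connected \<Omega>" "\<Omega> \<noteq> {}" "bounded \<Omega>"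
    and "open \<Omega>'" "closure \<Omega> \<subseteq> \<Omega>'"
    and "smooth_on U \<Omega>'"
    and "\<And>x. x \<in> \<Omega>' \<Longrightarrow> horiz_grad U x \<noteq> 0"
    and "\<And>x. x \<in> \<Omega>' \<Longrightarrow> normalized_p_laplacian p U x = 0"
    and "0 < \<epsilon>0" "\<epsilon>0 \<le> 1"
    and "\<And>\<epsilon>. 0 < \<epsilon> \<Longrightarrow> \<epsilon> < \<epsilon>0 \<Longrightarrow> extended_domain \<Omega> \<epsilon> \<subseteq> \<Omega>'"
    and "\<And>\<epsilon>. 0 < \<epsilon> \<Longrightarrow> \<epsilon> < \<epsilon>0 \<Longrightarrow> p_mean_solution p \<Omega> U \<epsilon> (u \<epsilon>)"
  shows "uniform_limit (closure \<Omega>) u U (at_right 0)"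
proof -
  note p = assms(1) and ne = assms(4)
  have U: "Ck_on 2 U \<Omega>'" using assms(8) by (simp add: smooth_on_def)
  then have contU: "continuous_on \<Omega>' U"
    by (simp add: numeral_2_eq_2 differentiable_imp_continuous_on)
  have C: "compact (closure \<Omega>)" using assms(5) by simp
  obtain r B where r: "r > 0" and B0: "B > 0"
    and B: "\<And>\<epsilon> y. 0 < \<epsilon> \<Longrightarrow> \<epsilon> < r \<Longrightarrow> y \<in> extended_domain \<Omega> \<epsilon> \<Longrightarrow> \<bar>U y\<bar> \<le> B"
    using bounded_on_extended_domains[OF assms(6,7,5,4) contU] by blast
  have BC: "\<bar>U y\<bar> \<le> B" if "y \<in> closure \<Omega>" for y
    using B[of "r / 2" y] closure_subset_extended_domain[of "r / 2" \<Omega>] r that by auto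
  show ?thesis
    unfolding uniform_limit_iff
  proof (intro allI impI)
    fix e :: real assume e: "e > 0"
    \<comment> \<open>The first bound makes \<open>\<sigma> + 2 * \<delta> * U\<close> nonzero on
      \<open>closure \<Omega>\<close>, so that \<open>V\<close> keeps a nonvanishing horizontal
      gradient; the second makes the final error \<open>\<delta> * B^2\<close> at most
      \<open>e / 2\<close>.\<close>
    define \<delta> where "\<delta> = min (1 / (4 * B)) (e / (2 * B\<^sup>2))"
    have \<delta>: "\<delta> > 0" using e B0 by (simp add: \<delta>_def)
    have "\<delta> * B \<le> 1 / (4 * B) * B" using B0 by (intro mult_right_mono) (auto simp: \<delta>_def)
    then have \<delta>B: "2 * (\<delta> * B) < 1" using B0 by simp
    have "\<delta> * B\<^sup>2 \<le> e / (2 * B\<^sup>2) * B\<^sup>2" by (intro mult_right_mono) (auto simp: \<delta>_def)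
    then have \<delta>B2: "\<delta> * B\<^sup>2 < e" using B0 e by simp
    have nz: "\<sigma> + 2 * \<delta> * U y \<noteq> 0" if "\<bar>\<sigma>\<bar> = 1" "y \<in> closure \<Omega>" for \<sigma> y
    proof
      assume "\<sigma> + 2 * \<delta> * U y = 0"
      then have "\<bar>\<sigma>\<bar> = \<bar>2 * \<delta> * U y\<bar>" by linarith
      also have "\<dots> = 2 * (\<delta> * \<bar>U y\<bar>)" using \<delta> by (simp add: abs_mult)
      also have "\<dots> \<le> 2 * (\<delta> * B)" using BC[OF that(2)] \<delta> by simp
      finally show False using that(1) \<delta>B by simp
    qed
    have "\<exists>r0>0. \<forall>\<epsilon> x. 0 < \<epsilon> \<longrightarrow> \<epsilon> < r0 \<longrightarrow> x \<in> closure \<Omega> \<longrightarrow> closure (heis_ball x \<epsilon>) \<subseteq> \<Omega>' \<and>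
      0 < (LINT y|lebesgue_on (closure (heis_ball x \<epsilon>)).
        spow p (\<sigma> * U y + \<delta> * (U y)\<^sup>2 - (\<sigma> * U x + \<delta> * (U x)\<^sup>2) - \<epsilon> ^ 3))" if "\<bar>\<sigma>\<bar> = 1" for \<sigma>
      using assms(7) by (intro strict_p_mean_inequality[OF p C assms(7,6) U] \<delta> nz assms(9,10) that) auto
    \<comment> \<open>The two signs give the two one-sided estimates; the factors \<open>1\<close>
      and \<open>-1\<close> are left as they stand in the instances for \<sigma>.\<close>
    from this[of 1] this[of "-1"] obtain r1 r2 where r12: "r1 > 0" "r2 > 0"
      and strict1: "\<And>\<epsilon> x. 0 < \<epsilon> \<Longrightarrow> \<epsilon> < r1 \<Longrightarrow> x \<in> closure \<Omega> \<Longrightarrow> closure (heis_ball x \<epsilon>) \<subseteq> \<Omega>' \<and>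
      0 < (LINT y|lebesgue_on (closure (heis_ball x \<epsilon>)).
        spow p (1 * U y + \<delta> * (U y)\<^sup>2 - (1 * U x + \<delta> * (U x)\<^sup>2) - \<epsilon> ^ 3))"
      and strict2: "\<And>\<epsilon> x. 0 < \<epsilon> \<Longrightarrow> \<epsilon> < r2 \<Longrightarrow> x \<in> closure \<Omega> \<Longrightarrow> closure (heis_ball x \<epsilon>) \<subseteq> \<Omega>' \<and>
      0 < (LINT y|lebesgue_on (closure (heis_ball x \<epsilon>)).
        spow p ((-1) * U y + \<delta> * (U y)\<^sup>2 - ((-1) * U x + \<delta> * (U x)\<^sup>2) - \<epsilon> ^ 3))"
      by (auto simp del: mult_1 mult_minus1)
    define b where "b = min (min \<epsilon>0 r) (min r1 r2)"
    have "\<forall>x\<in>closure \<Omega>. dist (u \<epsilon> x) (U x) < e" if \<epsilon>: "0 < \<epsilon>" "\<epsilon> < b" for \<epsilon>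
    proof
      fix x assume "x \<in> closure \<Omega>"
      then have x: "x \<in> extended_domain \<Omega> \<epsilon>" using closure_subset_extended_domain[OF \<epsilon>(1)] by blast
      have \<epsilon>': "\<epsilon> < \<epsilon>0" "\<epsilon> < r" "\<epsilon> < r1" "\<epsilon> < r2" using \<epsilon> by (auto simp: b_def)
      have sol: "p_mean_solution p \<Omega> U \<epsilon> (u \<epsilon>)" using assms(14) \<epsilon> \<epsilon>' by blast
      have \<Omega>C: "y \<in> closure \<Omega>" if "y \<in> \<Omega>" for y using that closure_subset by blast
      have "1 * (U x - u \<epsilon> x) \<le> \<delta> * B\<^sup>2"
        by (rule p_mean_solution_one_sided[OF p \<epsilon>(1) sol _ \<delta> contU])
          (use strict1[OF \<epsilon>(1) \<epsilon>'(3) \<Omega>C] B[OF \<epsilon>(1) \<epsilon>'(2)] x in auto)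
      moreover have "(-1) * (U x - u \<epsilon> x) \<le> \<delta> * B\<^sup>2"
        by (rule p_mean_solution_one_sided[OF p \<epsilon>(1) sol _ \<delta> contU])
          (use strict2[OF \<epsilon>(1) \<epsilon>'(4) \<Omega>C] B[OF \<epsilon>(1) \<epsilon>'(2)] x in auto)
      ultimately have "\<bar>u \<epsilon> x - U x\<bar> \<le> \<delta> * B\<^sup>2" by (simp add: abs_le_iff)
      then show "dist (u \<epsilon> x) (U x) < e" using \<delta>B2 by (simp add: dist_real_def)
    qed
    moreover have "b > 0" using assms(11) r r12 by (simp add: b_def)
    ultimately show "\<forall>\<^sub>F \<epsilon> in at_right 0. \<forall>x\<in>closure \<Omega>. dist (u \<epsilon> x) (U x) < e"
      unfolding eventually_at_right_field by blast
  qed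
qed

end
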